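(* Let $L=L_1\cup\cdots\cup L_\ell$ be an oriented ordered link represented by a link diagram $D$ with $m$ arcs. For each component signature $\tau\in\{0,1\}^\ell$, let $r_\tau$ be the rank of the integer matrix $M_\tau(D)$ and let $d_{\tau,1},\ldots,d_{\tau,r_\tau}$ be its nonzero (positive) Smith normal form entries. Then, for every $n\geq 3$, \[ \left|\operatorname{Hom}_{\mathrm{Qnd}}\bigl(Q(L),\operatorname{Conj}(D_n)\bigr)\right| =\sum_{\tau\in\{0,1\}^\ell} n^{m-r_\tau}\prod_{i=1}^{r_\tau}\gcd(d_{\tau,i},n). \]
   Context: Quandles. A quandle is a set $X$ with a binary operation $\triangleright$ such that $x\triangleright x=x$, each map $x\mapsto x\triangleright y$ is a bijection, and $(x\triangleright y)\triangleright z=(x\triangleright z)\triangleright(y\triangleright z)$. For a group $G$, $\operatorname{Conj}(G)$ is the set $G$ with $x\triangleright y=y^{-1}xy$. $\operatorname{Hom}_{\mathrm{Qnd}}$ denotes the set of quandle homomorphisms. $D_n=\langle r,s\mid r^n=e,\ s^2=e,\ srs=r^{-1}\rangle$ is the dihedral group of order $2n$. Diagram conventions. Let $D$ be a diagram of an oriented ordered link $L=L_1\cup\cdots\cup L_\ell$. An arc of $D$ is a maximal piece of the diagram running from one undercrossing to the next; a component with no undercrossings counts as a single arc. Let $m$ be the number of arcs and $k$ the number of crossings. At each crossing let $a$ be the over-arc; of the two under-arcs, the source $b$ is the one lying to the right of the oriented over-arc and the target $c$ is the one lying to its left (so at a positive crossing the source is the incoming under-arc and the target is the outgoing one, and at a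 negative crossing the roles are reversed). Fundamental quandle. $Q(L)$ is the quandle presented by the arcs of $D$ as generators with one relation $c=b\triangleright a$ for each crossing. Thus a quandle homomorphism $Q(L)\to T$ is the same as an assignment of elements of $T$ to the arcs of $D$ satisfying these relations. Component signature. A component signature is a vector $\tau=(\tau_1,\ldots,\tau_\ell)\in\{0,1\}^\ell$. An arc lying on $L_j$ is said to have type $\tau_j$. Signature matrix. Assign a variable $x_i$ to each arc of $D$. At a crossing with over-arc $a$ of type $\delta$ and under-arcs $b$ (source), $c$ (target), both of type $\epsilon$, form the integer linear relation $2\epsilon x_a+(-1)^\delta x_b-x_c=0$ (coefficients are added if some of $a,b,c$ coincide). The matrix $M_\tau(D)\in\operatorname{Mat}_{k\times m}(\mathbb{Z})$ has one row for each crossing, consisting of the coefficients of this relation. *)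

theory Defs
  imports
    "HOL-Algebra.Group"
    "HOL-Analysis.Product_Vector"
    "Jordan_Normal_Form.DL_Rank"
begin

section \<open>Quandles\<close>

record 'a quandle = "'a partial_object" +
  qop :: "'a \<Rightarrow> 'a \<Rightarrow> 'a"  (infixl \<open>\<triangleright>\<index>\<close> 70)

definition is_quandle :: "('a, 'b) quandle_scheme \<Rightarrow> bool" where
  "is_quandle X \<longleftrightarrow>
     (\<forall>x\<in>carrier X. x \<triangleright>\<^bsub>X\<^esub> x = x) \<and>
     (\<forall>y\<in>carrier X. bij_betw (\<lambda>x. x \<triangleright>\<^bsub>X\<^esub> y) (carrier X) (carrier X)) \<and>
     (\<forall>x\<in>carrier X. \<forall>y\<in>carrier X. \<forall>z\<in>carrier X.
        (x \<triangleright>\<^bsub>X\<^esub> y) \<triangleright>\<^bsub>X\<^esub> z = (x \<triangleright>\<^bsub>X\<^esub> z) \<triangleright>\<^bsub>X\<^esub> (y \<triangleright>\<^bsub>X\<^esub> z))"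

definition qnd_hom :: "('a, 'c) quandle_scheme \<Rightarrow> ('b, 'd) quandle_scheme \<Rightarrow> ('a \<Rightarrow> 'b) set" where
  "qnd_hom X Y = {f \<in> carrier X \<rightarrow>\<^sub>E carrier Y.
     \<forall>x\<in>carrier X. \<forall>y\<in>carrier X. f (x \<triangleright>\<^bsub>X\<^esub> y) = f x \<triangleright>\<^bsub>Y\<^esub> f y}"

definition Conj :: "('a, 'b) monoid_scheme \<Rightarrow> 'a quandle" where
  "Conj G = \<lparr>carrier = carrier G, qop = (\<lambda>x y. inv\<^bsub>G\<^esub> y \<otimes>\<^bsub>G\<^esub> x \<otimes>\<^bsub>G\<^esub> y)\<rparr>"

lemma is_quandle_Conj:
  fixes G (structure)
  assumes "group G" shows "is_quandle (Conj G)"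
proof -
  interpret group G by fact
  have canc: "inv y \<otimes> (y \<otimes> z) = z" "y \<otimes> (inv y \<otimes> z) = z"
    if "y \<in> carrier G" "z \<in> carrier G" for y z
    using that m_assoc[of "inv y" y z, symmetric] m_assoc[of y "inv y" z, symmetric] by auto
  have "bij_betw (\<lambda>x. inv y \<otimes> x \<otimes> y) (carrier G) (carrier G)" if y: "y \<in> carrier G" for y
    by (rule bij_betw_byWitness[where f' = "\<lambda>x. y \<otimes> x \<otimes> inv y"])
       (use y in \<open>auto simp: m_assoc canc\<close>)
  then show ?thesis
    by (auto simp: is_quandle_def Conj_def m_assoc canc inv_mult_group)
qed

text \<open>
  The quandle presented by generators \<open>X\<close> and relations \<open>R\<close>: terms over \<open>X\<close> in the operation
  \<open>\<triangleright>\<close> and in the operation inverse to it, modulo the least congruence that contains \<open>R\<close> and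
  satisfies the quandle axioms.
\<close>

datatype 'a qterm =
    QGen 'a
  | QOp "'a qterm" "'a qterm"
  | QInv "'a qterm" "'a qterm"

inductive_set qterms :: "'a set \<Rightarrow> 'a qterm set" for X where
  gen: "x \<in> X \<Longrightarrow> QGen x \<in> qterms X"
| op: "s \<in> qterms X \<Longrightarrow> t \<in> qterms X \<Longrightarrow> QOp s t \<in> qterms X"
| inv: "s \<in> qterms X \<Longrightarrow> t \<in> qterms X \<Longrightarrow> QInv s t \<in> qterms X"

inductive_set qcong :: "'a set \<Rightarrow> ('a qterm \<times> 'a qterm) set \<Rightarrow> ('a qterm \<times> 'a qterm) set"
  for X R where
  refl: "s \<in> qterms X \<Longrightarrow> (s, s) \<in> qcong X R"
| sym: "(s, t) \<in> qcong X R \<Longrightarrow> (t, s) \<in> qcong X R"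
| trans: "(s, t) \<in> qcong X R \<Longrightarrow> (t, u) \<in> qcong X R \<Longrightarrow> (s, u) \<in> qcong X R"
| op_cong: "(s, s') \<in> qcong X R \<Longrightarrow> (t, t') \<in> qcong X R \<Longrightarrow> (QOp s t, QOp s' t') \<in> qcong X R"
| inv_cong: "(s, s') \<in> qcong X R \<Longrightarrow> (t, t') \<in> qcong X R \<Longrightarrow> (QInv s t, QInv s' t') \<in> qcong X R"
| idem: "s \<in> qterms X \<Longrightarrow> (QOp s s, s) \<in> qcong X R"
| inv_op: "s \<in> qterms X \<Longrightarrow> t \<in> qterms X \<Longrightarrow> (QInv (QOp s t) t, s) \<in> qcong X R"
| op_inv: "s \<in> qterms X \<Longrightarrow> t \<in> qterms X \<Longrightarrow> (QOp (QInv s t) t, s) \<in> qcong X R"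
| dist: "s \<in> qterms X \<Longrightarrow> t \<in> qterms X \<Longrightarrow> u \<in> qterms X \<Longrightarrow>
    (QOp (QOp s t) u, QOp (QOp s u) (QOp t u)) \<in> qcong X R"
| rel: "(s, t) \<in> R \<Longrightarrow> s \<in> qterms X \<Longrightarrow> t \<in> qterms X \<Longrightarrow> (s, t) \<in> qcong X R"

definition presented_quandle ::
  "'a set \<Rightarrow> ('a qterm \<times> 'a qterm) set \<Rightarrow> 'a qterm set quandle" where
  "presented_quandle X R =
     \<lparr>carrier = qterms X // qcong X R,
      qop = (\<lambda>A B. \<Union>s\<in>A. \<Union>t\<in>B. qcong X R `` {QOp s t})\<rparr>"

lemma qcong_terms: "(s, t) \<in> qcong X R \<Longrightarrow> s \<in> qterms X \<and> t \<in> qterms X"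
  by (induction rule: qcong.induct) (auto intro: qterms.intros)

lemma equiv_qcong: "equiv (qterms X) (qcong X R)"
  by (rule equivI)
     (auto simp: refl_on_def intro: symI transI qcong.refl qcong.sym qcong.trans dest: qcong_terms)

lemma qop_presented_quandle:
  assumes "s \<in> qterms X" "t \<in> qterms X"
  shows "qcong X R `` {s} \<triangleright>\<^bsub>presented_quandle X R\<^esub> qcong X R `` {t} = qcong X R `` {QOp s t}"
proof -
  have "congruent2 (qcong X R) (qcong X R) (\<lambda>s t. qcong X R `` {QOp s t})"
    by (auto simp: congruent2_def intro!: equiv_class_eq[OF equiv_qcong] qcong.op_cong)
  from UN_equiv_class2[OF equiv_qcong equiv_qcong this assms] show ?thesis
    by (simp add: presented_quandle_def)
qed

lemma is_quandle_presented_quandle: "is_quandle (presented_quandle X R)"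
proof -
  let ?c = "\<lambda>s. qcong X R `` {s}"
  let ?Q = "presented_quandle X R"
  have car: "carrier ?Q = ?c ` qterms X"
    by (auto simp: presented_quandle_def quotient_def)
  have eq: "?c s = ?c t" if "(s, t) \<in> qcong X R" for s t
    using that by (rule equiv_class_eq[OF equiv_qcong])
  have iff: "?c s = ?c t \<longleftrightarrow> (s, t) \<in> qcong X R" if "s \<in> qterms X" "t \<in> qterms X" for s t
    using that by (simp add: eq_equiv_class_iff[OF equiv_qcong])
  note ops = qop_presented_quandle qterms.op
  have 1: "?c s \<triangleright>\<^bsub>?Q\<^esub> ?c s = ?c s" if "s \<in> qterms X" for s
    using that by (simp add: ops eq[OF qcong.idem])
  have 2: "bij_betw (\<lambda>A. A \<triangleright>\<^bsub>?Q\<^esub> ?c t) (carrier ?Q) (carrier ?Q)" if t: "t \<in> qterms X" for t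
  proof (rule bij_betw_imageI)
    show "inj_on (\<lambda>A. A \<triangleright>\<^bsub>?Q\<^esub> ?c t) (carrier ?Q)"
    proof (rule inj_onI)
      fix A B
      assume "A \<in> carrier ?Q" "B \<in> carrier ?Q" and e: "A \<triangleright>\<^bsub>?Q\<^esub> ?c t = B \<triangleright>\<^bsub>?Q\<^esub> ?c t"
      then obtain s u where su: "s \<in> qterms X" "u \<in> qterms X" "A = ?c s" "B = ?c u"
        by (auto simp: car)
      with e t have "(QOp s t, QOp u t) \<in> qcong X R"
        by (simp add: ops iff)
      then have "(QInv (QOp s t) t, QInv (QOp u t) t) \<in> qcong X R"
        using t by (intro qcong.inv_cong qcong.refl)
      with su t have "(s, u) \<in> qcong X R"
        by (meson qcong.inv_op qcong.sym qcong.trans)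
      then show "A = B" using su eq by simp
    qed
    show "(\<lambda>A. A \<triangleright>\<^bsub>?Q\<^esub> ?c t) ` carrier ?Q = carrier ?Q"
    proof (intro equalityI subsetI)
      fix B assume "B \<in> carrier ?Q"
      then obtain s where s: "s \<in> qterms X" "B = ?c s" by (auto simp: car)
      then have "B = ?c (QInv s t) \<triangleright>\<^bsub>?Q\<^esub> ?c t"
        using t by (simp add: ops qterms.inv eq[OF qcong.op_inv])
      then show "B \<in> (\<lambda>A. A \<triangleright>\<^bsub>?Q\<^esub> ?c t) ` carrier ?Q"
        using s t by (auto simp: car intro: qterms.inv)
    qed (use t in \<open>auto simp: car ops\<close>)
  qed
  have 3: "(?c s \<triangleright>\<^bsub>?Q\<^esub> ?c t) \<triangleright>\<^bsub>?Q\<^esub> ?c u = (?c s \<triangleright>\<^bsub>?Q\<^esub> ?c u) \<triangleright>\<^bsub>?Q\<^esub> (?c t \<triangleright>\<^bsub>?Q\<^esub> ?c u)"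
    if "s \<in> qterms X" "t \<in> qterms X" "u \<in> qterms X" for s t u
    using that eq[OF qcong.dist, OF that] by (simp add: ops)
  from 1 2 3 show ?thesis by (auto simp: is_quandle_def car)
qed

section \<open>Presented groups and dihedral groups\<close>

datatype 'a gterm =
    GGen 'a
  | GOne
  | GMul "'a gterm" "'a gterm"
  | GInv "'a gterm"

inductive_set gcong :: "('a gterm \<times> 'a gterm) set \<Rightarrow> ('a gterm \<times> 'a gterm) set" for R where
  refl: "(s, s) \<in> gcong R"
| sym: "(s, t) \<in> gcong R \<Longrightarrow> (t, s) \<in> gcong R"
| trans: "(s, t) \<in> gcong R \<Longrightarrow> (t, u) \<in> gcong R \<Longrightarrow> (s, u) \<in> gcong R"
| mul_cong: "(s, s') \<in> gcong R \<Longrightarrow> (t, t') \<in> gcong R \<Longrightarrow> (GMul s t, GMul s' t') \<in> gcong R"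
| inv_cong: "(s, s') \<in> gcong R \<Longrightarrow> (GInv s, GInv s') \<in> gcong R"
| assoc: "(GMul (GMul s t) u, GMul s (GMul t u)) \<in> gcong R"
| l_one: "(GMul GOne s, s) \<in> gcong R"
| l_inv: "(GMul (GInv s) s, GOne) \<in> gcong R"
| rel: "(s, t) \<in> R \<Longrightarrow> (s, t) \<in> gcong R"

definition presented_group :: "('a gterm \<times> 'a gterm) set \<Rightarrow> 'a gterm set monoid" where
  "presented_group R =
     \<lparr>carrier = UNIV // gcong R,
      mult = (\<lambda>A B. \<Union>s\<in>A. \<Union>t\<in>B. gcong R `` {GMul s t}),
      one = gcong R `` {GOne}\<rparr>"

lemma equiv_gcong: "equiv UNIV (gcong R)"
  by (rule equivI)
     (auto simp: refl_on_def intro: symI transI gcong.refl gcong.sym gcong.trans)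

lemma mult_presented_group:
  "gcong R `` {s} \<otimes>\<^bsub>presented_group R\<^esub> gcong R `` {t} = gcong R `` {GMul s t}"
proof -
  have "congruent2 (gcong R) (gcong R) (\<lambda>s t. gcong R `` {GMul s t})"
    by (auto simp: congruent2_def intro!: equiv_class_eq[OF equiv_gcong] gcong.mul_cong)
  from UN_equiv_class2[OF equiv_gcong equiv_gcong this UNIV_I UNIV_I] show ?thesis
    by (simp add: presented_group_def)
qed

lemma group_presented_group: "group (presented_group R)"
proof -
  let ?c = "\<lambda>s. gcong R `` {s}"
  let ?G = "presented_group R"
  have car: "carrier ?G = range ?c"
    by (auto simp: presented_group_def quotient_def)
  have one: "\<one>\<^bsub>?G\<^esub> = ?c GOne"
    by (simp add: presented_group_def)
  have eq: "?c s = ?c t" if "(s, t) \<in> gcong R" for s t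
    using that by (rule equiv_class_eq[OF equiv_gcong])
  show ?thesis
  proof (rule groupI)
    fix x assume "x \<in> carrier ?G"
    then obtain s where s: "x = ?c s" by (auto simp: car)
    have "?c (GInv s) \<otimes>\<^bsub>?G\<^esub> x = \<one>\<^bsub>?G\<^esub>"
      by (simp add: s one mult_presented_group eq[OF gcong.l_inv])
    then show "\<exists>y\<in>carrier ?G. y \<otimes>\<^bsub>?G\<^esub> x = \<one>\<^bsub>?G\<^esub>"
      by (auto simp: car)
  qed (auto simp: car one mult_presented_group eq[OF gcong.assoc] eq[OF gcong.l_one])
qed

datatype dihedral_gen = Rot | Refl

definition gpow :: "'a gterm \<Rightarrow> nat \<Rightarrow> 'a gterm" where
  "gpow t n = (GMul t ^^ n) GOne"

definition dihedral :: "nat \<Rightarrow> dihedral_gen gterm set monoid" where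
  "dihedral n = (let r = GGen Rot; s = GGen Refl in
     presented_group {(gpow r n, GOne), (gpow s 2, GOne), (GMul (GMul s r) s, GInv r)})"

section \<open>Oriented ordered links and their diagrams\<close>

text \<open>
  Space is \<open>complex \<times> real\<close>: horizontal plane and height. An ordered oriented link with \<open>l\<close>
  components is given by closed curves \<open>K j\<close>, \<open>j < l\<close>, of period 1, oriented by the parameter.
  The pair \<open>(j, t)\<close> with \<open>0 \<le> t < 1\<close> stands for the point \<open>K j t\<close> of the link, and also for
  the corresponding point of its diagram, the projection of the link to the plane.
\<close>

type_synonym link_point = "nat \<times> real"

definition link_points :: "nat \<Rightarrow> link_point set" where
  "link_points l = {..<l} \<times> {0..<1}"

definition is_link :: "nat \<Rightarrow> (nat \<Rightarrow> real \<Rightarrow> complex \<times> real) \<Rightarrow> bool" where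
  "is_link l K \<longleftrightarrow>
     (\<forall>j<l. continuous_on UNIV (K j) \<and> (\<forall>t. K j (t + 1) = K j t)) \<and>
     inj_on (\<lambda>(j, t). K j t) (link_points l)"

definition plane_proj :: "(nat \<Rightarrow> real \<Rightarrow> complex \<times> real) \<Rightarrow> link_point \<Rightarrow> complex" where
  "plane_proj K p = fst (K (fst p) (snd p))"

definition height :: "(nat \<Rightarrow> real \<Rightarrow> complex \<times> real) \<Rightarrow> link_point \<Rightarrow> real" where
  "height K p = snd (K (fst p) (snd p))"

definition has_velocity ::
  "(nat \<Rightarrow> real \<Rightarrow> complex \<times> real) \<Rightarrow> link_point \<Rightarrow> complex \<Rightarrow> bool" where
  "has_velocity K p v \<longleftrightarrow> ((\<lambda>t. fst (K (fst p) t)) has_vector_derivative v) (at (snd p))"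

definition velocity :: "(nat \<Rightarrow> real \<Rightarrow> complex \<times> real) \<Rightarrow> link_point \<Rightarrow> complex" where
  "velocity K p = (THE v. has_velocity K p v)"

text \<open>A crossing is the pair of its upper and its lower point.\<close>

definition crossings ::
  "nat \<Rightarrow> (nat \<Rightarrow> real \<Rightarrow> complex \<times> real) \<Rightarrow> (link_point \<times> link_point) set" where
  "crossings l K = {(p, q). p \<in> link_points l \<and> q \<in> link_points l \<and>
     plane_proj K p = plane_proj K q \<and> height K p > height K q}"

text \<open>
  The determinant of the vectors \<open>v\<close>, \<open>w\<close> of the plane: positive if \<open>w\<close> points to the left of
  \<open>v\<close>, negative if it points to the right.
\<close>

definition det2 :: "complex \<Rightarrow> complex \<Rightarrow> real" where
  "det2 v w = Re v * Im w - Im v * Re w"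

text \<open>
  The projection is a link diagram if its only multiple points are finitely many transverse double
  points. Away from the crossings only continuity is required, so that smooth and polygonal
  diagrams are both covered.
\<close>

definition link_diagram :: "nat \<Rightarrow> (nat \<Rightarrow> real \<Rightarrow> complex \<times> real) \<Rightarrow> bool" where
  "link_diagram l K \<longleftrightarrow>
     is_link l K \<and>
     finite (crossings l K) \<and>
     (\<forall>p\<in>link_points l. \<forall>q\<in>link_points l. \<forall>r\<in>link_points l.
        plane_proj K p = plane_proj K q \<and> plane_proj K q = plane_proj K r \<longrightarrow> p = q \<or> q = r \<or> p = r) \<and>
     (\<forall>(p, q)\<in>crossings l K.
        \<exists>v w. has_velocity K p v \<and> has_velocity K q w \<and> det2 v w \<noteq> 0)"

definition undercrossings ::
  "nat \<Rightarrow> (nat \<Rightarrow> real \<Rightarrow> complex \<times> real) \<Rightarrow> link_point set" where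
  "undercrossings l K = snd ` crossings l K"

text \<open>
  The points that can be reached from a given one by travelling forward, respectively backward,
  along its component without meeting an undercrossing; the starting point itself does not count.
\<close>

definition piece_after ::
  "nat \<Rightarrow> (nat \<Rightarrow> real \<Rightarrow> complex \<times> real) \<Rightarrow> link_point \<Rightarrow> link_point set" where
  "piece_after l K p = {(fst p, frac (snd p + s)) |s. s > 0 \<and>
     (\<forall>s'. 0 < s' \<and> s' \<le> s \<longrightarrow> (fst p, frac (snd p + s')) \<notin> undercrossings l K)}"

definition piece_before ::
  "nat \<Rightarrow> (nat \<Rightarrow> real \<Rightarrow> complex \<times> real) \<Rightarrow> link_point \<Rightarrow> link_point set" where
  "piece_before l K p = {(fst p, frac (snd p - s)) |s. s > 0 \<and>
     (\<forall>s'. 0 < s' \<and> s' \<le> s \<longrightarrow> (fst p, frac (snd p - s')) \<notin> undercrossings l K)}"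

text \<open>
  Arcs are taken without their end points. On a component without undercrossings both pieces are
  the whole component.
\<close>

definition arc_through ::
  "nat \<Rightarrow> (nat \<Rightarrow> real \<Rightarrow> complex \<times> real) \<Rightarrow> link_point \<Rightarrow> link_point set" where
  "arc_through l K p = piece_before l K p \<union> {p} \<union> piece_after l K p"

definition arcs ::
  "nat \<Rightarrow> (nat \<Rightarrow> real \<Rightarrow> complex \<times> real) \<Rightarrow> link_point set set" where
  "arcs l K = arc_through l K ` (link_points l - undercrossings l K)"

definition arc_component :: "link_point set \<Rightarrow> nat" where
  "arc_component A = (THE j. fst ` A = {j})"

definition over_arc ::
  "nat \<Rightarrow> (nat \<Rightarrow> real \<Rightarrow> complex \<times> real) \<Rightarrow> link_point \<times> link_point \<Rightarrow> link_point set" where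
  "over_arc l K c = arc_through l K (fst c)"

text \<open>
  At a crossing with velocities \<open>v\<close> (over) and \<open>w\<close> (under), the incoming under-arc leaves the
  crossing point in the direction \<open>- w\<close> and the outgoing one in the direction \<open>w\<close>. So the incoming
  one is to the right of the over-arc iff \<open>det2 v w > 0\<close>, that is, iff the crossing is positive.
\<close>

definition source_arc ::
  "nat \<Rightarrow> (nat \<Rightarrow> real \<Rightarrow> complex \<times> real) \<Rightarrow> link_point \<times> link_point \<Rightarrow> link_point set" where
  "source_arc l K c =
     (if det2 (velocity K (fst c)) (velocity K (snd c)) > 0
      then piece_before l K (snd c) else piece_after l K (snd c))"

definition target_arc ::
  "nat \<Rightarrow> (nat \<Rightarrow> real \<Rightarrow> complex \<times> real) \<Rightarrow> link_point \<times> link_point \<Rightarrow> link_point set" where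
  "target_arc l K c =
     (if det2 (velocity K (fst c)) (velocity K (snd c)) > 0
      then piece_after l K (snd c) else piece_before l K (snd c))"

definition fundamental_quandle ::
  "nat \<Rightarrow> (nat \<Rightarrow> real \<Rightarrow> complex \<times> real) \<Rightarrow> link_point set qterm set quandle" where
  "fundamental_quandle l K = presented_quandle (arcs l K)
     ((\<lambda>c. (QGen (target_arc l K c), QOp (QGen (source_arc l K c)) (QGen (over_arc l K c))))
        ` crossings l K)"

section \<open>Signature matrices\<close>

definition signatures :: "nat \<Rightarrow> (nat \<Rightarrow> nat) set" where
  "signatures l = {..<l} \<rightarrow>\<^sub>E {0, 1}"

definition arc_type :: "(nat \<Rightarrow> nat) \<Rightarrow> link_point set \<Rightarrow> nat" where
  "arc_type \<tau> A = \<tau> (arc_component A)"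

text \<open>The lists \<open>cs\<close> and \<open>as\<close> enumerate the crossings and the arcs.\<close>

definition signature_matrix ::
  "nat \<Rightarrow> (nat \<Rightarrow> real \<Rightarrow> complex \<times> real) \<Rightarrow> (link_point \<times> link_point) list \<Rightarrow>
   link_point set list \<Rightarrow> (nat \<Rightarrow> nat) \<Rightarrow> int mat" where
  "signature_matrix l K cs as \<tau> = mat (length cs) (length as) (\<lambda>(i, j).
     let a = over_arc l K (cs ! i); b = source_arc l K (cs ! i); c = target_arc l K (cs ! i);
         \<delta> = arc_type \<tau> a; \<epsilon> = arc_type \<tau> b
     in (if as ! j = a then 2 * int \<epsilon> else 0)
        + (if as ! j = b then (- 1) ^ \<delta> else 0)
        + (if as ! j = c then - 1 else 0))"

definition int_mat_rank :: "int mat \<Rightarrow> nat" where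
  "int_mat_rank A = vec_space.rank (dim_row A) (map_mat rat_of_int A)"

text \<open>\<open>ds\<close> lists the nonzero diagonal entries of the Smith normal form of \<open>A\<close>.\<close>

definition smith_entries :: "int mat \<Rightarrow> nat list \<Rightarrow> bool" where
  "smith_entries A ds \<longleftrightarrow>
     length ds \<le> min (dim_row A) (dim_col A) \<and>
     (\<forall>i<length ds. ds ! i > 0) \<and>
     (\<forall>i. Suc i < length ds \<longrightarrow> ds ! i dvd ds ! Suc i) \<and>
     (\<exists>P\<in>carrier_mat (dim_row A) (dim_row A). \<exists>Q\<in>carrier_mat (dim_col A) (dim_col A).
        invertible_mat P \<and> invertible_mat Q \<and>
        P * A * Q = mat (dim_row A) (dim_col A)
          (\<lambda>(i, j). if i = j \<and> i < length ds then int (ds ! i) else 0))"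

end

theory Submission imports Defs
begin

text \<open>
  A homomorphism from the fundamental quandle to a quandle \<open>T\<close> is a coloring of the arcs by elements
  of \<open>T\<close> that satisfies the relation of every crossing (\<open>qnd_hom_presented_bij\<close>). For the conjugation
  quandle of the dihedral group, write each color uniquely as \<open>s\<^sup>e r\<^sup>x\<close> with \<open>e \<in> {0, 1}\<close> and \<open>x\<close>
  modulo \<open>n\<close> (\<open>dihedral_elem_bij\<close>). The dihedral group is given by a presentation, so uniqueness
  needs a model in which the words can be told apart (\<open>normal_form_cong\<close>).

  Conjugating \<open>s\<^sup>\<epsilon> r\<^sup>b\<close> by \<open>s\<^sup>\<delta> r\<^sup>a\<close> gives \<open>s\<^sup>\<epsilon> r\<^sup>c\<close> with \<open>c = 2 \<epsilon> a + (- 1)\<^sup>\<delta> b\<close>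
  (\<open>dihedral_elem_conj\<close>). So the two under-arcs at a crossing have the same \<open>e\<close>. Travelling along a
  component, one passes from arc to arc through undercrossings, hence \<open>e\<close> is constant on components
  (\<open>label_constant_on_component\<close>), which makes it a component signature \<open>\<tau>\<close>. For fixed \<open>\<tau>\<close> the
  relations that remain are linear equations for the exponents modulo \<open>n\<close>, and their matrix is the
  signature matrix. The colorings are thus the disjoint union over \<open>\<tau>\<close> of the kernels modulo \<open>n\<close> of
  the signature matrices (\<open>coloring_bij\<close>, \<open>card_crossing_solutions\<close>).

  The kernel of an integer matrix modulo \<open>n\<close> keeps its size when the matrix is multiplied by
  integer matrices that are invertible over the integers, so it can be counted on the Smith normal
  form: a diagonal entry \<open>d\<close> leaves \<open>gcd d n\<close> values for its coordinate, and a coordinate without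
  nonzero entry has all \<open>n\<close> values. The number of nonzero entries is the rank
  (\<open>smith_rank_and_kernel\<close>).
\<close>

section \<open>Homomorphisms from a presented quandle\<close>

text \<open>
  The value of \<open>QInv\<close> is not a choice: in a quandle every right translation is a bijection, so
  there is exactly one element that it sends to the value of \<open>s\<close>.
\<close>

primrec qterm_eval :: "('b, 'c) quandle_scheme \<Rightarrow> ('a \<Rightarrow> 'b) \<Rightarrow> 'a qterm \<Rightarrow> 'b" where
  "qterm_eval T g (QGen x) = g x"
| "qterm_eval T g (QOp s t) = qterm_eval T g s \<triangleright>\<^bsub>T\<^esub> qterm_eval T g t"
| "qterm_eval T g (QInv s t) =
    inv_into (carrier T) (\<lambda>x. x \<triangleright>\<^bsub>T\<^esub> qterm_eval T g t) (qterm_eval T g s)"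

lemma quandle_laws:
  assumes "is_quandle T"
  shows quandle_idem: "x \<in> carrier T \<Longrightarrow> x \<triangleright>\<^bsub>T\<^esub> x = x"
    and quandle_bij: "y \<in> carrier T \<Longrightarrow> bij_betw (\<lambda>x. x \<triangleright>\<^bsub>T\<^esub> y) (carrier T) (carrier T)"
    and quandle_dist: "x \<in> carrier T \<Longrightarrow> y \<in> carrier T \<Longrightarrow> z \<in> carrier T \<Longrightarrow>
      (x \<triangleright>\<^bsub>T\<^esub> y) \<triangleright>\<^bsub>T\<^esub> z = (x \<triangleright>\<^bsub>T\<^esub> z) \<triangleright>\<^bsub>T\<^esub> (y \<triangleright>\<^bsub>T\<^esub> z)"
  using assms by (auto simp: is_quandle_def)

lemma quandle_closed:
  "is_quandle T \<Longrightarrow> x \<in> carrier T \<Longrightarrow> y \<in> carrier T \<Longrightarrow> x \<triangleright>\<^bsub>T\<^esub> y \<in> carrier T"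
  using quandle_bij[of T y] by (auto simp: bij_betw_def)

lemma quandle_inv:
  assumes "is_quandle T" "x \<in> carrier T" "y \<in> carrier T"
  shows "inv_into (carrier T) (\<lambda>x. x \<triangleright>\<^bsub>T\<^esub> y) x \<in> carrier T"
    and "inv_into (carrier T) (\<lambda>x. x \<triangleright>\<^bsub>T\<^esub> y) x \<triangleright>\<^bsub>T\<^esub> y = x"
    and "inv_into (carrier T) (\<lambda>x. x \<triangleright>\<^bsub>T\<^esub> y) (x \<triangleright>\<^bsub>T\<^esub> y) = x"
proof -
  note b = quandle_bij[OF assms(1,3)]
  then have "x \<in> (\<lambda>x. x \<triangleright>\<^bsub>T\<^esub> y) ` carrier T"
    using assms(2) by (simp add: bij_betw_def)
  then show "inv_into (carrier T) (\<lambda>x. x \<triangleright>\<^bsub>T\<^esub> y) x \<in> carrier T"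
    "inv_into (carrier T) (\<lambda>x. x \<triangleright>\<^bsub>T\<^esub> y) x \<triangleright>\<^bsub>T\<^esub> y = x"
    by (rule inv_into_into, rule f_inv_into_f)
  show "inv_into (carrier T) (\<lambda>x. x \<triangleright>\<^bsub>T\<^esub> y) (x \<triangleright>\<^bsub>T\<^esub> y) = x"
    using b assms(2) by (intro inv_into_f_eq) (auto simp: bij_betw_def)
qed

lemma qterm_eval_closed:
  assumes "is_quandle T" "g \<in> X \<rightarrow> carrier T" "s \<in> qterms X"
  shows "qterm_eval T g s \<in> carrier T"
  using assms(3)
  by induction (use assms(1,2) in \<open>auto intro: quandle_closed quandle_inv\<close>)

lemma qterm_eval_cong:
  assumes T: "is_quandle T" and g: "g \<in> X \<rightarrow> carrier T"
    and R: "\<And>s t. (s, t) \<in> R \<Longrightarrow> s \<in> qterms X \<Longrightarrow> t \<in> qterms X \<Longrightarrow> qterm_eval T g s = qterm_eval T g t"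
    and st: "(s, t) \<in> qcong X R"
  shows "qterm_eval T g s = qterm_eval T g t"
  using st
proof induction
  case (dist s t u)
  then show ?case
    using quandle_dist[OF T] qterm_eval_closed[OF T g] by simp
qed (use R in \<open>simp_all add: quandle_idem[OF T] quandle_inv[OF T] qterm_eval_closed[OF T g]\<close>)

text \<open>
  This is the universal property of a presentation. A homomorphism sends the class of a term to
  the value of the term, since it also has to respect the operation inverse to \<open>\<triangleright>\<close>; so it
  is determined by the images of the generators. Conversely, evaluation is constant on the classes of
  the congruence, because the target satisfies the quandle axioms and the values satisfy the
  relations.
\<close>

lemma qnd_hom_presented_bij:
  fixes X :: "'a set" and T :: "('b, 'c) quandle_scheme"
  assumes T: "is_quandle T"
  shows "bij_betw (\<lambda>f. \<lambda>x\<in>X. f (qcong X R `` {QGen x})) (qnd_hom (presented_quandle X R) T)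
    {g \<in> X \<rightarrow>\<^sub>E carrier T. \<forall>(s, t)\<in>R. s \<in> qterms X \<longrightarrow> t \<in> qterms X \<longrightarrow>
      qterm_eval T g s = qterm_eval T g t}"
    (is "bij_betw ?res ?H ?A")
proof (rule bij_betw_imageI)
  let ?c = "\<lambda>s. qcong X R `` {s}"
  let ?Q = "presented_quandle X R"
  have car: "carrier ?Q = ?c ` qterms X"
    by (auto simp: presented_quandle_def quotient_def)
  have f_eval: "f (?c s) = qterm_eval T (?res f) s" if f: "f \<in> ?H" and "s \<in> qterms X" for f s
    using that(2)
  proof induction
    case (op s t)
    have "f (?c (QOp s t)) = f (?c s \<triangleright>\<^bsub>?Q\<^esub> ?c t)"
      using op by (simp add: qop_presented_quandle)
    also have "\<dots> = f (?c s) \<triangleright>\<^bsub>T\<^esub> f (?c t)"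
      using f op by (auto simp: qnd_hom_def car)
    finally show ?case using op by simp
  next
    case (inv s t)
    have "f (?c s) = f (?c (QOp (QInv s t) t))"
      using equiv_class_eq[OF equiv_qcong qcong.op_inv[OF inv.hyps]] by simp
    also have "\<dots> = f (?c (QInv s t) \<triangleright>\<^bsub>?Q\<^esub> ?c t)"
      using inv by (simp add: qop_presented_quandle qterms.inv)
    also have "\<dots> = f (?c (QInv s t)) \<triangleright>\<^bsub>T\<^esub> f (?c t)"
      using f inv.hyps qterms.inv[OF inv.hyps] by (auto simp: qnd_hom_def car)
    finally have "f (?c s) = f (?c (QInv s t)) \<triangleright>\<^bsub>T\<^esub> f (?c t)" .
    moreover have "f (?c (QInv s t)) \<in> carrier T" "f (?c t) \<in> carrier T"
      using f inv.hyps qterms.inv[OF inv.hyps] by (auto simp: qnd_hom_def car)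
    ultimately show ?case
      using inv quandle_inv(3)[OF T] by (metis qterm_eval.simps(3))
  qed simp
  show "inj_on ?res ?H"
  proof (rule inj_onI)
    fix f h assume f: "f \<in> ?H" and h: "h \<in> ?H" and eq: "?res f = ?res h"
    have "f A = h A" if "A \<in> carrier ?Q" for A
      using that f_eval[OF f] f_eval[OF h] eq by (auto simp: car)
    then show "f = h"
      using f h by (auto simp: qnd_hom_def intro: PiE_ext)
  qed
  show "?res ` ?H = ?A"
  proof (intro equalityI subsetI)
    fix g assume "g \<in> ?res ` ?H"
    then obtain f where f: "f \<in> ?H" "g = ?res f" by blast
    have "qterm_eval T g s = qterm_eval T g t"
      if "(s, t) \<in> R" "s \<in> qterms X" "t \<in> qterms X" for s t
    proof -
      have "?c s = ?c t"
        using that by (intro equiv_class_eq[OF equiv_qcong] qcong.rel)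
      then show ?thesis using f f_eval that by metis
    qed
    moreover have "g \<in> X \<rightarrow>\<^sub>E carrier T"
      using f by (auto simp: qnd_hom_def car intro!: qterms.gen)
    ultimately show "g \<in> ?A" by auto
  next
    fix g assume "g \<in> ?A"
    then have g: "g \<in> X \<rightarrow>\<^sub>E carrier T" and
      R: "\<And>s t. (s, t) \<in> R \<Longrightarrow> s \<in> qterms X \<Longrightarrow> t \<in> qterms X \<Longrightarrow>
        qterm_eval T g s = qterm_eval T g t"
      by auto
    then have g': "g \<in> X \<rightarrow> carrier T" by auto
    define f where "f = (\<lambda>A\<in>carrier ?Q. qterm_eval T g (SOME s. s \<in> A \<inter> qterms X))"
    have f: "f (?c s) = qterm_eval T g s" if "s \<in> qterms X" for s
    proof -
      have "s \<in> ?c s \<inter> qterms X" using that by (auto intro: qcong.refl)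
      then have "(SOME u. u \<in> ?c s \<inter> qterms X) \<in> ?c s" by (metis IntD1 someI)
      then have "(s, SOME u. u \<in> ?c s \<inter> qterms X) \<in> qcong X R" by simp
      then have "qterm_eval T g s = qterm_eval T g (SOME u. u \<in> ?c s \<inter> qterms X)"
        using qterm_eval_cong[OF T g'] R by blast
      then show ?thesis using that by (simp add: f_def car)
    qed
    have "f \<in> ?H"
      using qterm_eval_closed[OF T g'] f
      by (auto simp: qnd_hom_def car qop_presented_quandle qterms.op f_def[THEN fun_cong, of "_"] restrict_def PiE_iff extensional_def)
    moreover have "?res f = g"
      using g f qterms.gen by (fastforce simp: PiE_iff extensional_def)
    ultimately show "g \<in> ?res ` ?H" by blast
  qed
qed

section \<open>Normal forms in the dihedral group\<close>

text \<open>
  To see that the words \<open>s\<^sup>e r\<^sup>x\<close> with \<open>e \<in> {0, 1}\<close> and \<open>0 \<le> x < n\<close> are pairwise distinct in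
  the presented group, one needs a model of it. Here the pair \<open>(e, x)\<close> stands for \<open>s\<^sup>e r\<^sup>x\<close>, with
  an integer \<open>x\<close> that is compared modulo \<open>n\<close> only at the end; multiplication moves the rotation
  past the reflection by \<open>r\<^sup>x s = s r\<^bsup>-x\<^esup>\<close>. The reflection is put first so that conjugation takes
  the form \<open>2 \<epsilon> a + (- 1)\<^sup>\<delta> b\<close> of the signature matrix; with \<open>r\<^sup>x s\<^sup>e\<close> the sign of
  \<open>2 \<epsilon> a\<close> would depend on \<open>\<delta>\<close>.
\<close>

definition dihedral_mult :: "nat \<times> int \<Rightarrow> nat \<times> int \<Rightarrow> nat \<times> int" where
  "dihedral_mult p q = ((fst p + fst q) mod 2, (- 1) ^ fst q * snd p + snd q)"

definition dihedral_inv :: "nat \<times> int \<Rightarrow> nat \<times> int" where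
  "dihedral_inv p = (fst p, - ((- 1) ^ fst p * snd p))"

primrec gterm_normal_form :: "dihedral_gen gterm \<Rightarrow> nat \<times> int" where
  "gterm_normal_form (GGen x) = (case x of Rot \<Rightarrow> (0, 1) | Refl \<Rightarrow> (1, 0))"
| "gterm_normal_form GOne = (0, 0)"
| "gterm_normal_form (GMul s t) = dihedral_mult (gterm_normal_form s) (gterm_normal_form t)"
| "gterm_normal_form (GInv s) = dihedral_inv (gterm_normal_form s)"

lemma gterm_normal_form_type: "fst (gterm_normal_form s) = 0 \<or> fst (gterm_normal_form s) = Suc 0"
  by (induction s) (auto simp: dihedral_mult_def dihedral_inv_def split: dihedral_gen.split)

definition dihedral_rels :: "nat \<Rightarrow> (dihedral_gen gterm \<times> dihedral_gen gterm) set" where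
  "dihedral_rels n = {(gpow (GGen Rot) n, GOne), (gpow (GGen Refl) 2, GOne),
     (GMul (GMul (GGen Refl) (GGen Rot)) (GGen Refl), GInv (GGen Rot))}"

lemma dihedral_eq: "dihedral n = presented_group (dihedral_rels n)"
  by (simp add: dihedral_def dihedral_rels_def Let_def)

lemma gpow_Suc: "gpow t (Suc k) = GMul t (gpow t k)"
  by (simp add: gpow_def)

lemma gpow_0: "gpow t 0 = GOne"
  by (simp add: gpow_def)

lemma normal_form_rot_pow: "gterm_normal_form (gpow (GGen Rot) k) = (0, int k)"
  by (induction k) (auto simp: gpow_0 gpow_Suc dihedral_mult_def)

text \<open>
  The model satisfies the group laws and the dihedral relations, so congruent words have the same
  normal form modulo \<open>n\<close>. This bounds the order of the presented group from below.
\<close>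

lemma normal_form_cong:
  assumes "(s, t) \<in> gcong (dihedral_rels n)"
  shows "fst (gterm_normal_form s) = fst (gterm_normal_form t) \<and>
    int n dvd snd (gterm_normal_form s) - snd (gterm_normal_form t)"
  using assms
proof induction
  case (sym s t)
  then show ?case by (metis dvd_minus_iff minus_diff_eq)
next
  case (trans s t u)
  then have "int n dvd (snd (gterm_normal_form s) - snd (gterm_normal_form t)) +
    (snd (gterm_normal_form t) - snd (gterm_normal_form u))"
    by (intro dvd_add) auto
  with trans show ?case by simp
next
  case (mul_cong s s' t t')
  then have "int n dvd (- 1) ^ fst (gterm_normal_form t) *
      (snd (gterm_normal_form s) - snd (gterm_normal_form s')) +
    (snd (gterm_normal_form t) - snd (gterm_normal_form t'))"
    by (intro dvd_add dvd_mult) auto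
  with mul_cong show ?case by (simp add: dihedral_mult_def algebra_simps)
next
  case (inv_cong s s')
  then have "int n dvd - ((- 1) ^ fst (gterm_normal_form s) *
      (snd (gterm_normal_form s) - snd (gterm_normal_form s')))"
    by simp
  with inv_cong show ?case by (simp add: dihedral_inv_def algebra_simps)
next
  case (assoc s t u)
  show ?case
    using gterm_normal_form_type[of s] gterm_normal_form_type[of t] gterm_normal_form_type[of u]
    by (elim disjE) (auto simp: dihedral_mult_def)
next
  case (l_one s)
  show ?case using gterm_normal_form_type[of s] by (auto simp: dihedral_mult_def)
next
  case (l_inv s)
  show ?case using gterm_normal_form_type[of s] by (auto simp: dihedral_mult_def dihedral_inv_def)
next
  case (rel s t)
  then show ?case
    by (auto simp: dihedral_rels_def normal_form_rot_pow numeral_2_eq_2 gpow_Suc gpow_0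
        dihedral_mult_def dihedral_inv_def)
qed simp

abbreviation dihedral_class :: "nat \<Rightarrow> dihedral_gen gterm \<Rightarrow> dihedral_gen gterm set" where
  "dihedral_class n s \<equiv> gcong (dihedral_rels n) `` {s}"

definition dihedral_elem :: "nat \<Rightarrow> nat \<Rightarrow> int \<Rightarrow> dihedral_gen gterm set" where
  "dihedral_elem n e x = dihedral_class n (GGen Refl) [^]\<^bsub>dihedral n\<^esub> e \<otimes>\<^bsub>dihedral n\<^esub>
     dihedral_class n (GGen Rot) [^]\<^bsub>dihedral n\<^esub> x"

lemma group_dihedral: "group (dihedral n)"
  by (simp add: dihedral_eq group_presented_group)

lemma carrier_dihedral: "carrier (dihedral n) = range (dihedral_class n)"
  by (auto simp: dihedral_eq presented_group_def quotient_def)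

lemma mult_dihedral:
  "dihedral_class n s \<otimes>\<^bsub>dihedral n\<^esub> dihedral_class n t = dihedral_class n (GMul s t)"
  by (simp add: dihedral_eq mult_presented_group)

lemma one_dihedral: "\<one>\<^bsub>dihedral n\<^esub> = dihedral_class n GOne"
  by (simp add: dihedral_eq presented_group_def)

lemma dihedral_class_eq:
  "dihedral_class n s = dihedral_class n t \<longleftrightarrow> (s, t) \<in> gcong (dihedral_rels n)"
  by (simp add: eq_equiv_class_iff[OF equiv_gcong])

lemma inv_dihedral: "inv\<^bsub>dihedral n\<^esub> dihedral_class n s = dihedral_class n (GInv s)"
proof -
  have "dihedral_class n (GInv s) \<otimes>\<^bsub>dihedral n\<^esub> dihedral_class n s = \<one>\<^bsub>dihedral n\<^esub>"
    by (simp add: mult_dihedral one_dihedral dihedral_class_eq gcong.l_inv del: Image_singleton_iff)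
  then show ?thesis
    by (intro group.inv_equality[OF group_dihedral]) (auto simp: carrier_dihedral)
qed

lemma nat_pow_dihedral:
  "dihedral_class n s [^]\<^bsub>dihedral n\<^esub> k = dihedral_class n (gpow s k)" for k :: nat
proof (induction k)
  case 0
  then show ?case by (simp add: one_dihedral gpow_0)
next
  case (Suc k)
  interpret group "dihedral n" by (rule group_dihedral)
  have "dihedral_class n s [^]\<^bsub>dihedral n\<^esub> Suc k =
      dihedral_class n s \<otimes>\<^bsub>dihedral n\<^esub> dihedral_class n s [^]\<^bsub>dihedral n\<^esub> k"
    by (rule nat_pow_Suc2) (auto simp: carrier_dihedral)
  with Suc show ?case by (simp add: mult_dihedral gpow_Suc)
qed

text \<open>
  If conjugation by \<open>s\<close> inverts \<open>r\<close>, it inverts every power of \<open>r\<close>. The induction runs over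
  natural exponents; negative ones follow by multiplying with the inverse power on both sides.
\<close>

lemma (in group) conj_int_pow:
  assumes "s \<in> carrier G" "r \<in> carrier G" "s \<otimes> r = inv r \<otimes> s"
  shows "r [^] (x :: int) \<otimes> s = s \<otimes> r [^] (- x)"
proof -
  have 1: "r [^] k \<otimes> s = s \<otimes> inv (r [^] k)" for k :: nat
  proof (induction k)
    case 0 then show ?case using assms by simp
  next
    case (Suc k)
    have rs: "r \<otimes> s = s \<otimes> inv r"
    proof -
      have "s \<otimes> inv r = r \<otimes> (inv r \<otimes> s) \<otimes> inv r"
        using assms(1,2) by (simp add: m_assoc[symmetric])
      also have "\<dots> = r \<otimes> (s \<otimes> r) \<otimes> inv r" using assms(3) by simp
      also have "\<dots> = r \<otimes> s" using assms(1,2) by (simp add: m_assoc)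
      finally show ?thesis by simp
    qed
    have "r [^] Suc k \<otimes> s = r [^] k \<otimes> (r \<otimes> s)"
      using assms by (simp add: m_assoc)
    also have "\<dots> = (r [^] k \<otimes> s) \<otimes> inv r"
      using assms by (simp add: rs m_assoc)
    also have "\<dots> = s \<otimes> (inv (r [^] k) \<otimes> inv r)"
      using assms by (simp add: Suc m_assoc)
    also have "inv (r [^] k) \<otimes> inv r = inv (r \<otimes> r [^] k)"
      using assms by (simp add: inv_mult_group)
    also have "r \<otimes> r [^] k = r [^] Suc k"
      using assms(2) nat_pow_Suc2 by simp
    finally show ?case .
  qed
  have 2: "inv (r [^] k) \<otimes> s = s \<otimes> r [^] k" for k :: nat
  proof -
    have "inv (r [^] k) \<otimes> s = inv (r [^] k) \<otimes> (s \<otimes> inv (r [^] k)) \<otimes> r [^] k"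
      using assms by (simp add: m_assoc)
    also have "\<dots> = inv (r [^] k) \<otimes> (r [^] k \<otimes> s) \<otimes> r [^] k" by (simp add: 1)
    also have "\<dots> = s \<otimes> r [^] k"
      using assms by (simp add: m_assoc[symmetric])
    finally show ?thesis .
  qed
  show ?thesis
  proof (cases x)
    case (nonneg k)
    then show ?thesis using 1[of k] assms by (simp add: int_pow_int int_pow_neg)
  next
    case (neg k)
    then have "x = - int (Suc k)" by simp
    then show ?thesis using 2[of "Suc k"] assms(2) by (simp only: int_pow_neg int_pow_int minus_minus)
  qed
qed

lemma dihedral_elem_mult:
  assumes "e \<in> {0, 1}" "f \<in> {0, 1}"
  shows "dihedral_elem n e x \<otimes>\<^bsub>dihedral n\<^esub> dihedral_elem n f y =
    dihedral_elem n ((e + f) mod 2) ((- 1) ^ f * x + y)"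
proof -
  interpret group "dihedral n" by (rule group_dihedral)
  let ?G = "dihedral n"
  define r s where "r = dihedral_class n (GGen Rot)" and "s = dihedral_class n (GGen Refl)"
  have rs: "r \<in> carrier ?G" "s \<in> carrier ?G"
    by (auto simp: r_def s_def carrier_dihedral)
  have "s \<otimes>\<^bsub>?G\<^esub> r \<otimes>\<^bsub>?G\<^esub> s = inv\<^bsub>?G\<^esub> r"
    unfolding r_def s_def mult_dihedral inv_dihedral dihedral_class_eq
    by (rule gcong.rel) (simp add: dihedral_rels_def)
  moreover have "s [^]\<^bsub>?G\<^esub> (2::nat) = \<one>\<^bsub>?G\<^esub>"
    unfolding s_def nat_pow_dihedral one_dihedral dihedral_class_eq
    by (rule gcong.rel) (simp add: dihedral_rels_def)
  then have ss: "s \<otimes>\<^bsub>?G\<^esub> s = \<one>\<^bsub>?G\<^esub>"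
    using rs by (simp add: numeral_2_eq_2)
  ultimately have "s \<otimes>\<^bsub>?G\<^esub> r = inv\<^bsub>?G\<^esub> r \<otimes>\<^bsub>?G\<^esub> s"
    using rs by (metis m_assoc m_closed r_one)
  then have swap: "r [^]\<^bsub>?G\<^esub> x \<otimes>\<^bsub>?G\<^esub> s = s \<otimes>\<^bsub>?G\<^esub> r [^]\<^bsub>?G\<^esub> (- x)" for x :: int
    using rs by (intro conj_int_pow)
  have swap': "r [^]\<^bsub>?G\<^esub> x \<otimes>\<^bsub>?G\<^esub> (s \<otimes>\<^bsub>?G\<^esub> z) = s \<otimes>\<^bsub>?G\<^esub> (r [^]\<^bsub>?G\<^esub> (- x) \<otimes>\<^bsub>?G\<^esub> z)"
    if "z \<in> carrier ?G" for x :: int and z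
    using that rs swap by (simp add: m_assoc[symmetric])
  have ss': "s \<otimes>\<^bsub>?G\<^esub> (s \<otimes>\<^bsub>?G\<^esub> z) = z" if "z \<in> carrier ?G" for z
    using that rs ss by (simp add: m_assoc[symmetric])
  have add: "r [^]\<^bsub>?G\<^esub> x \<otimes>\<^bsub>?G\<^esub> r [^]\<^bsub>?G\<^esub> y = r [^]\<^bsub>?G\<^esub> (x + y)" for x y :: int
    using rs by (simp add: int_pow_mult)
  show ?thesis
    using assms rs
    by (auto simp: dihedral_elem_def r_def[symmetric] s_def[symmetric] m_assoc swap' ss' add)
qed

lemma dihedral_elem_closed: "dihedral_elem n e x \<in> carrier (dihedral n)"
proof -
  interpret group "dihedral n" by (rule group_dihedral)
  show ?thesis by (auto simp: dihedral_elem_def carrier_dihedral[symmetric]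
    intro!: m_closed int_pow_closed nat_pow_closed) (auto simp: carrier_dihedral)
qed

lemma dihedral_elem_zero: "dihedral_elem n 0 0 = \<one>\<^bsub>dihedral n\<^esub>"
proof -
  interpret group "dihedral n" by (rule group_dihedral)
  show ?thesis by (simp add: dihedral_elem_def)
qed

lemma dihedral_elem_inv:
  assumes "e \<in> {0, 1}"
  shows "inv\<^bsub>dihedral n\<^esub> dihedral_elem n e x = dihedral_elem n e (- ((- 1) ^ e * x))"
proof (rule group.inv_equality[OF group_dihedral])
  show "dihedral_elem n e (- ((- 1) ^ e * x)) \<otimes>\<^bsub>dihedral n\<^esub> dihedral_elem n e x = \<one>\<^bsub>dihedral n\<^esub>"
    using assms by (auto simp: dihedral_elem_mult simp flip: dihedral_elem_zero)
qed (rule dihedral_elem_closed)+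

text \<open>
  This formula is the origin of the signature matrix: conjugation keeps the coset \<open>\<epsilon>\<close> of the
  conjugated element, and once both cosets are fixed it is linear in the exponents.
\<close>

lemma dihedral_elem_conj:
  assumes "\<delta> \<in> {0, 1}" "\<epsilon> \<in> {0, 1}"
  shows "dihedral_elem n \<epsilon> b \<triangleright>\<^bsub>Conj (dihedral n)\<^esub> dihedral_elem n \<delta> a =
    dihedral_elem n \<epsilon> (2 * int \<epsilon> * a + (- 1) ^ \<delta> * b)"
  using assms
  by (auto simp: Conj_def dihedral_elem_inv dihedral_elem_mult)

text \<open>
  The elements \<open>s\<^sup>e r\<^sup>x\<close> contain the generators and multiply as in the model, so every word reduces to
  one of them; this bounds the order from above.
\<close>

lemma dihedral_class_normal_form:
  "dihedral_class n s = dihedral_elem n (fst (gterm_normal_form s)) (snd (gterm_normal_form s))"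
proof (induction s)
  case (GGen x)
  interpret group "dihedral n" by (rule group_dihedral)
  have "dihedral_class n (GGen y) \<in> carrier (dihedral n)" for y
    by (auto simp: carrier_dihedral)
  then show ?case
    by (auto simp: dihedral_elem_def int_pow_1 split: dihedral_gen.split)
next
  case GOne
  then show ?case by (simp add: dihedral_elem_zero one_dihedral)
next
  case (GMul s t)
  then show ?case
    using gterm_normal_form_type[of s] gterm_normal_form_type[of t]
    by (simp add: mult_dihedral[symmetric] dihedral_elem_mult dihedral_mult_def)
next
  case (GInv s)
  then show ?case
    using gterm_normal_form_type[of s]
    by (simp add: inv_dihedral[symmetric] dihedral_elem_inv dihedral_inv_def)
qed

lemma dihedral_elem_mod: "dihedral_elem n e x = dihedral_elem n e (x mod int n)"
proof -
  interpret group "dihedral n" by (rule group_dihedral)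
  let ?r = "dihedral_class n (GGen Rot)"
  have r: "?r \<in> carrier (dihedral n)" by (auto simp: carrier_dihedral)
  have "?r [^]\<^bsub>dihedral n\<^esub> n = \<one>\<^bsub>dihedral n\<^esub>"
    unfolding nat_pow_dihedral one_dihedral dihedral_class_eq
    by (rule gcong.rel) (simp add: dihedral_rels_def)
  then have "?r [^]\<^bsub>dihedral n\<^esub> int n = \<one>\<^bsub>dihedral n\<^esub>"
    by (simp add: int_pow_int)
  then have "?r [^]\<^bsub>dihedral n\<^esub> (int n * (x div int n)) = \<one>\<^bsub>dihedral n\<^esub>"
    using r by (simp add: int_pow_pow[symmetric])
  then have "?r [^]\<^bsub>dihedral n\<^esub> x = ?r [^]\<^bsub>dihedral n\<^esub> (x mod int n)"
    using int_pow_mult[OF r, of "int n * (x div int n)" "x mod int n"] r by simp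
  then show ?thesis by (simp add: dihedral_elem_def)
qed

lemma dihedral_elem_bij:
  assumes "n > 0"
  shows "bij_betw (\<lambda>(e, x). dihedral_elem n e x) ({0, 1} \<times> {0..<int n}) (carrier (dihedral n))"
proof (rule bij_betw_imageI)
  show "inj_on (\<lambda>(e, x). dihedral_elem n e x) ({0, 1} \<times> {0..<int n})"
  proof (rule inj_onI, clarify)
    fix e f :: nat and x y :: int
    assume e: "e \<in> {0, 1}" and f: "f \<in> {0, 1}" and xy: "x \<in> {0..<int n}" "y \<in> {0..<int n}"
      and eq: "dihedral_elem n e x = dihedral_elem n f y"
    \<comment> \<open>A word with normal form \<open>(e, x)\<close>, so that equal elements can be compared in the model.\<close>
    define t where "t e x = GMul (gpow (GGen Refl) e) (gpow (GGen Rot) (nat x))" for e x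
    have nf: "gterm_normal_form (t e x) = (e, x)" if "e \<in> {0, 1}" "x \<in> {0..<int n}" for e x
      using that by (auto simp: t_def dihedral_mult_def normal_form_rot_pow gpow_0 gpow_Suc)
    have "dihedral_class n (t e x) = dihedral_class n (t f y)"
      using eq by (simp only: dihedral_class_normal_form nf[OF e xy(1)] nf[OF f xy(2)] fst_conv snd_conv)
    then have "(t e x, t f y) \<in> gcong (dihedral_rels n)"
      by (simp only: dihedral_class_eq)
    from normal_form_cong[OF this] have "e = f" "int n dvd x - y"
      by (simp_all add: nf[OF e xy(1)] nf[OF f xy(2)])
    moreover have "x = y"
      using xy \<open>int n dvd x - y\<close> by (metis atLeastLessThan_iff mod_eq_dvd_iff mod_pos_pos_trivial)
    ultimately show "e = f \<and> x = y" by simp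
  qed
  show "(\<lambda>(e, x). dihedral_elem n e x) ` ({0, 1} \<times> {0..<int n}) = carrier (dihedral n)"
  proof (intro equalityI subsetI)
    fix A assume "A \<in> carrier (dihedral n)"
    then obtain s where "A = dihedral_class n s" by (auto simp: carrier_dihedral)
    then have A: "A = dihedral_elem n (fst (gterm_normal_form s)) (snd (gterm_normal_form s) mod int n)"
      by (simp only: dihedral_class_normal_form flip: dihedral_elem_mod)
    show "A \<in> (\<lambda>(e, x). dihedral_elem n e x) ` ({0, 1} \<times> {0..<int n})"
      unfolding A using gterm_normal_form_type[of s] assms
      by (intro image_eqI[of _ _ "(fst (gterm_normal_form s), snd (gterm_normal_form s) mod int n)"]) auto
  qed (auto intro: dihedral_elem_closed)
qed

lemma dihedral_elem_eq_iff:
  assumes "n > 0" "e \<in> {0, 1}" "f \<in> {0, 1}"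
  shows "dihedral_elem n e x = dihedral_elem n f y \<longleftrightarrow> e = f \<and> int n dvd x - y"
proof -
  have "dihedral_elem n e x = dihedral_elem n f y \<longleftrightarrow>
      dihedral_elem n e (x mod int n) = dihedral_elem n f (y mod int n)"
    by (simp flip: dihedral_elem_mod)
  also have "\<dots> \<longleftrightarrow> e = f \<and> x mod int n = y mod int n"
    using inj_on_eq_iff[OF bij_betw_imp_inj_on[OF dihedral_elem_bij[OF assms(1)]],
        of "(e, x mod int n)" "(f, y mod int n)"] assms by auto
  finally show ?thesis by (simp add: mod_eq_dvd_iff)
qed

section \<open>Arcs of a link diagram\<close>

text \<open>
  A component is a circle. It is unrolled to the real line, where "between" makes sense: the
  undercrossings become a periodic set of parameters, and arcs become images of intervals that avoid
  this set.
\<close>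

definition under_params :: "nat \<Rightarrow> (nat \<Rightarrow> real \<Rightarrow> complex \<times> real) \<Rightarrow> nat \<Rightarrow> real set" where
  "under_params l K j = {t. (j, frac t) \<in> undercrossings l K}"

definition free_interval ::
  "nat \<Rightarrow> (nat \<Rightarrow> real \<Rightarrow> complex \<times> real) \<Rightarrow> nat \<Rightarrow> real \<Rightarrow> real set" where
  "free_interval l K j t = {u. {min t u..max t u} \<inter> under_params l K j = {}}"

definition curve_arc ::
  "nat \<Rightarrow> (nat \<Rightarrow> real \<Rightarrow> complex \<times> real) \<Rightarrow> nat \<Rightarrow> real \<Rightarrow> link_point set" where
  "curve_arc l K j t = (\<lambda>u. (j, frac u)) ` free_interval l K j t"

lemma frac_frac_add: "frac (frac t + s) = frac (t + s)" for t s :: real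
proof -
  have "frac t + s = (t + s) + of_int (- \<lfloor>t\<rfloor>)"
    by (simp add: frac_def)
  then show ?thesis
    by (metis frac_add_of_int_right)
qed

lemma frac_frac_diff: "frac (frac t - s) = frac (t - s)" for t s :: real
  using frac_frac_add[of t "- s"] by simp

lemma piece_after_params:
  "piece_after l K (j, frac t) =
    (\<lambda>u. (j, frac u)) ` {u. t < u \<and> {t<..u} \<inter> under_params l K j = {}}"
proof -
  have free: "(\<forall>s'. 0 < s' \<and> s' \<le> s \<longrightarrow> (j, frac (t + s')) \<notin> undercrossings l K) \<longleftrightarrow>
      {t<..t + s} \<inter> under_params l K j = {}" for s
  proof -
    have "{t<..t + s} \<inter> under_params l K j = {} \<longleftrightarrow>
        (\<forall>x\<in>(+) t ` {0<..s}. x \<notin> under_params l K j)"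
      by auto
    also have "\<dots> \<longleftrightarrow> (\<forall>s'\<in>{0<..s}. t + s' \<notin> under_params l K j)"
      by (simp only: ball_simps)
    finally show ?thesis by (auto simp: under_params_def)
  qed
  have "piece_after l K (j, frac t) =
      {(j, frac (t + s)) |s. s > 0 \<and> {t<..t + s} \<inter> under_params l K j = {}}"
    by (simp add: piece_after_def frac_frac_add free)
  also have "\<dots> = (\<lambda>u. (j, frac u)) ` {u. t < u \<and> {t<..u} \<inter> under_params l K j = {}}"
    (is "?A = ?f ` ?B")
  proof (intro equalityI subsetI)
    fix p assume "p \<in> ?f ` ?B"
    then obtain u where "p = ?f u" "u \<in> ?B" by blast
    then show "p \<in> ?A" by (intro CollectI exI[of _ "u - t"]) simp
  qed auto
  finally show ?thesis .
qed

lemma piece_before_params: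
  "piece_before l K (j, frac t) =
    (\<lambda>u. (j, frac u)) ` {u. u < t \<and> {u..<t} \<inter> under_params l K j = {}}"
proof -
  have free: "(\<forall>s'. 0 < s' \<and> s' \<le> s \<longrightarrow> (j, frac (t - s')) \<notin> undercrossings l K) \<longleftrightarrow>
      {t - s..<t} \<inter> under_params l K j = {}" for s
  proof -
    have "{t - s..<t} \<inter> under_params l K j = {} \<longleftrightarrow>
        (\<forall>x\<in>(-) t ` {0<..s}. x \<notin> under_params l K j)"
      by auto
    also have "\<dots> \<longleftrightarrow> (\<forall>s'\<in>{0<..s}. t - s' \<notin> under_params l K j)"
      by (simp only: ball_simps)
    finally show ?thesis by (auto simp: under_params_def)
  qed
  have "piece_before l K (j, frac t) =
      {(j, frac (t - s)) |s. s > 0 \<and> {t - s..<t} \<inter> under_params l K j = {}}"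
    by (simp add: piece_before_def frac_frac_diff free)
  also have "\<dots> = (\<lambda>u. (j, frac u)) ` {u. u < t \<and> {u..<t} \<inter> under_params l K j = {}}"
    (is "?A = ?f ` ?B")
  proof (intro equalityI subsetI)
    fix p assume "p \<in> ?f ` ?B"
    then obtain u where "p = ?f u" "u \<in> ?B" by blast
    then show "p \<in> ?A" by (intro CollectI exI[of _ "t - u"]) simp
  qed auto
  finally show ?thesis .
qed

text \<open>
  The pieces before and after a point, which are defined separately by travelling in one
  direction, fit together to the set of all parameters that can be joined to \<open>t\<close> without meeting an
  undercrossing.
\<close>

lemma arc_through_params:
  assumes "t \<notin> under_params l K j"
  shows "arc_through l K (j, frac t) = curve_arc l K j t"
proof -
  have "{u. u < t \<and> {u..<t} \<inter> under_params l K j = {}} \<union> {t} \<union>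
      {u. t < u \<and> {t<..u} \<inter> under_params l K j = {}} = free_interval l K j t"
  proof (rule Set.set_eqI)
    fix u
    show "u \<in> {u. u < t \<and> {u..<t} \<inter> under_params l K j = {}} \<union> {t} \<union>
        {u. t < u \<and> {t<..u} \<inter> under_params l K j = {}} \<longleftrightarrow> u \<in> free_interval l K j t"
    proof (cases u t rule: linorder_cases)
      case less
      then have "{min t u..max t u} = insert t {u..<t}" by auto
      with less assms show ?thesis by (auto simp: free_interval_def)
    next
      case greater
      then have "{min t u..max t u} = insert t {t<..u}" by auto
      with greater assms show ?thesis by (auto simp: free_interval_def)
    qed (use assms in \<open>auto simp: free_interval_def\<close>)
  qed
  then show ?thesis
    by (auto simp: arc_through_def piece_before_params piece_after_params curve_arc_def)
qed

lemma curve_arc_cong: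
  assumes "{min t u..max t u} \<inter> under_params l K j = {}"
  shows "curve_arc l K j t = curve_arc l K j u"
proof -
  have "{min t w..max t w} \<subseteq> {min t u..max t u} \<union> {min u w..max u w}"
    "{min u w..max u w} \<subseteq> {min t u..max t u} \<union> {min t w..max t w}" for w
    by (auto simp: min_le_iff_disj le_max_iff_disj)
  then have "free_interval l K j t = free_interval l K j u"
    using assms unfolding free_interval_def by blast
  then show ?thesis by (simp add: curve_arc_def)
qed

text \<open>
  An under-arc at a crossing is one of the arcs of the diagram: the piece that starts at an
  undercrossing is the arc through any parameter that follows before the next undercrossing. Being
  stopped by the undercrossing at \<open>t\<close> itself keeps this arc from extending backward.
\<close>

lemma piece_after_eq_curve_arc:
  assumes "t \<in> under_params l K j" "t < u" "{t<..u} \<inter> under_params l K j = {}"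
  shows "piece_after l K (j, frac t) = curve_arc l K j u"
proof -
  have "(t < w \<and> {t<..w} \<inter> under_params l K j = {}) \<longleftrightarrow>
      {min u w..max u w} \<inter> under_params l K j = {}" for w
  proof (cases "t < w")
    case True
    then have "{t<..w} \<subseteq> {t<..u} \<union> {min u w..max u w}" "{min u w..max u w} \<subseteq> {t<..u} \<union> {t<..w}"
      using assms(2) by (auto simp: min_le_iff_disj le_max_iff_disj)
    with True assms(3) show ?thesis by blast
  next
    case False
    then have "t \<in> {min u w..max u w}" using assms(2) by auto
    with False assms(1) show ?thesis by blast
  qed
  then have "{w. t < w \<and> {t<..w} \<inter> under_params l K j = {}} = free_interval l K j u"
    by (simp add: free_interval_def)
  then show ?thesis by (simp add: piece_after_params curve_arc_def)
qed

lemma piece_before_eq_curve_arc: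
  assumes "t \<in> under_params l K j" "u < t" "{u..<t} \<inter> under_params l K j = {}"
  shows "piece_before l K (j, frac t) = curve_arc l K j u"
proof -
  have "(w < t \<and> {w..<t} \<inter> under_params l K j = {}) \<longleftrightarrow>
      {min u w..max u w} \<inter> under_params l K j = {}" for w
  proof (cases "w < t")
    case True
    then have "{w..<t} \<subseteq> {u..<t} \<union> {min u w..max u w}" "{min u w..max u w} \<subseteq> {u..<t} \<union> {w..<t}"
      using assms(2) by (auto simp: min_le_iff_disj le_max_iff_disj)
    with True assms(3) show ?thesis by blast
  next
    case False
    then have "t \<in> {min u w..max u w}" using assms(2) by auto
    with False assms(1) show ?thesis by blast
  qed
  then have "{w. w < t \<and> {w..<t} \<inter> under_params l K j = {}} = free_interval l K j u"
    by (simp add: free_interval_def)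
  then show ?thesis by (simp add: piece_before_params curve_arc_def)
qed

lemma undercrossings_subset: "undercrossings l K \<subseteq> link_points l"
  by (auto simp: undercrossings_def crossings_def)

lemma arcs_eq_curve_arcs: "arcs l K = {curve_arc l K j t |j t. j < l \<and> t \<notin> under_params l K j}"
proof (intro equalityI subsetI)
  fix A assume "A \<in> arcs l K"
  then obtain j t where "j < l" "0 \<le> t" "t < 1" "(j, t) \<notin> undercrossings l K"
    and A: "A = arc_through l K (j, t)"
    by (auto simp: arcs_def link_points_def)
  then have "frac t = t" "t \<notin> under_params l K j"
    by (auto simp: frac_eq under_params_def)
  with A \<open>j < l\<close> show "A \<in> {curve_arc l K j t |j t. j < l \<and> t \<notin> under_params l K j}"
    using arc_through_params[of t l K j] by auto
next
  fix A assume "A \<in> {curve_arc l K j t |j t. j < l \<and> t \<notin> under_params l K j}"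
  then obtain j t where "j < l" "t \<notin> under_params l K j" "A = arc_through l K (j, frac t)"
    by (auto simp: arc_through_params)
  then show "A \<in> arcs l K"
    by (auto simp: arcs_def link_points_def under_params_def frac_lt_1)
qed

lemma arc_component_curve_arc:
  assumes "t \<notin> under_params l K j"
  shows "arc_component (curve_arc l K j t) = j"
proof -
  have "t \<in> free_interval l K j t"
    using assms by (simp add: free_interval_def)
  then have "fst ` curve_arc l K j t = {j}"
    by (auto simp: curve_arc_def image_iff)
  then show ?thesis by (simp add: arc_component_def)
qed

text \<open>
  Only finitely many translates \<open>v + k\<close> of undercrossing parameters come near \<open>t\<close>, so \<open>t\<close> has a
  punctured neighbourhood without any. Everything below about arcs near a point rests on this.
\<close>

lemma eventually_not_under_param:
  assumes "finite (undercrossings l K)"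
  shows "eventually (\<lambda>u. u \<notin> under_params l K j) (at t)"
proof -
  let ?F = "(\<lambda>(v, k). v + of_int k) ` (snd ` undercrossings l K \<times> {\<lfloor>t\<rfloor> - 1..\<lfloor>t\<rfloor> + 1})"
  have "finite ?F" using assms by simp
  then have "open (- (?F - {t}))"
    by (intro open_Compl finite_imp_closed) simp
  then have "eventually (\<lambda>u. u \<in> - (?F - {t})) (at t)"
    by (rule eventually_at_in_open') simp
  then have "eventually (\<lambda>u. u \<notin> ?F) (at t)"
    using eventually_neq_at_within[of t t UNIV] by eventually_elim simp
  moreover have "eventually (\<lambda>u. u \<in> {t - 1<..<t + 1}) (at t)"
    by (rule eventually_at_in_open') auto
  ultimately show ?thesis
  proof eventually_elim
    case (elim u)
    have "\<lfloor>u\<rfloor> \<in> {\<lfloor>t\<rfloor> - 1..\<lfloor>t\<rfloor> + 1}"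
      using elim(2) by (auto; linarith)
    moreover have "u = frac u + of_int \<lfloor>u\<rfloor>" by (simp add: frac_def)
    ultimately have "u \<in> ?F" if "(j, frac u) \<in> undercrossings l K"
      using that by (intro image_eqI[of _ _ "(frac u, \<lfloor>u\<rfloor>)"]) (auto simp: image_iff intro!: bexI[rotated])
    with elim(1) show ?case by (auto simp: under_params_def)
  qed
qed

lemma punctured_interval_free:
  assumes "finite (undercrossings l K)"
  obtains e where "e > 0" "\<And>u. u \<noteq> t \<Longrightarrow> \<bar>u - t\<bar> < e \<Longrightarrow> u \<notin> under_params l K j"
  using eventually_not_under_param[OF assms, of j t]
  by (auto simp: eventually_at dist_real_def)

lemma exists_arc:
  assumes "finite (undercrossings l K)" "j < l"
  shows "\<exists>A\<in>arcs l K. arc_component A = j"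
proof -
  obtain e where "e > 0" "\<And>u. u \<noteq> 0 \<Longrightarrow> \<bar>u - 0\<bar> < e \<Longrightarrow> u \<notin> under_params l K j"
    using punctured_interval_free[OF assms(1), where t = 0] by blast
  then have "e / 2 \<notin> under_params l K j" by simp
  then show ?thesis
    using assms(2) arc_component_curve_arc by (fastforce simp: arcs_eq_curve_arcs)
qed

lemma under_pieces:
  assumes "finite (undercrossings l K)" "q \<in> undercrossings l K"
  shows "piece_after l K q \<in> arcs l K" "piece_before l K q \<in> arcs l K"
    "arc_component (piece_after l K q) = fst q" "arc_component (piece_before l K q) = fst q"
proof -
  have "q \<in> link_points l" using assms(2) undercrossings_subset by blast
  then obtain j t where q: "q = (j, t)" "j < l" "frac t = t"
    by (auto simp: link_points_def frac_eq)
  then have t: "t \<in> under_params l K j" using assms(2) by (simp add: under_params_def)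
  obtain e where e: "e > 0" "\<And>u. u \<noteq> t \<Longrightarrow> \<bar>u - t\<bar> < e \<Longrightarrow> u \<notin> under_params l K j"
    using punctured_interval_free[OF assms(1), where t = t] by blast
  have "piece_after l K (j, frac t) = curve_arc l K j (t + e / 2)"
    by (rule piece_after_eq_curve_arc[OF t]) (use e in \<open>auto simp: disjoint_iff\<close>)
  moreover have "piece_before l K (j, frac t) = curve_arc l K j (t - e / 2)"
    by (rule piece_before_eq_curve_arc[OF t]) (use e in \<open>auto simp: disjoint_iff\<close>)
  moreover have "t + e / 2 \<notin> under_params l K j" "t - e / 2 \<notin> under_params l K j"
    using e by auto
  ultimately show "piece_after l K q \<in> arcs l K" "piece_before l K q \<in> arcs l K"
    "arc_component (piece_after l K q) = fst q" "arc_component (piece_before l K q) = fst q"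
    using q by (auto simp: arcs_eq_curve_arcs arc_component_curve_arc)
qed

text \<open>
  A label of the arcs that does not change when an undercrossing is passed gives a locally
  constant function on the unrolled component; the real line is connected, so the function is
  constant. At an undercrossing parameter the function takes the label of the arc that starts
  there; either of the two adjacent arcs would do.
\<close>

lemma label_constant_on_component:
  fixes f :: "link_point set \<Rightarrow> 'b"
  assumes fin: "finite (undercrossings l K)"
    and pass: "\<And>q. q \<in> undercrossings l K \<Longrightarrow> f (piece_before l K q) = f (piece_after l K q)"
    and A: "A \<in> arcs l K" and B: "B \<in> arcs l K" and "arc_component A = arc_component B"
  shows "f A = f B"
proof -
  obtain j t where j: "j < l" and t: "t \<notin> under_params l K j" "A = curve_arc l K j t"
    using A by (auto simp: arcs_eq_curve_arcs)
  obtain j' u where "u \<notin> under_params l K j'" "B = curve_arc l K j' u"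
    using B by (auto simp: arcs_eq_curve_arcs)
  with assms(5) t have u: "u \<notin> under_params l K j" "B = curve_arc l K j u"
    by (auto simp: arc_component_curve_arc)
  define g where "g t = f (if t \<in> under_params l K j then piece_after l K (j, frac t)
    else curve_arc l K j t)" for t
  have "eventually (\<lambda>w. g v = g w) (at v)" for v
  proof -
    obtain e where e: "e > 0" "\<And>u. u \<noteq> v \<Longrightarrow> \<bar>u - v\<bar> < e \<Longrightarrow> u \<notin> under_params l K j"
      using punctured_interval_free[OF fin, where t = v] by blast
    have "g v = g w" if w: "w \<noteq> v" "\<bar>w - v\<bar> < e" for w
    proof -
      have gw: "g w = f (curve_arc l K j w)" using e w by (simp add: g_def)
      show ?thesis
      proof (cases "v \<in> under_params l K j")
        case v: True
        have gv: "g v = f (piece_after l K (j, frac v))" using v by (simp add: g_def)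
        show ?thesis
        proof (cases "v < w")
          case True
          then have "piece_after l K (j, frac v) = curve_arc l K j w"
            using e w by (intro piece_after_eq_curve_arc[OF v]) (auto simp: disjoint_iff)
          then show ?thesis by (simp add: gv gw)
        next
          case False
          then have "piece_before l K (j, frac v) = curve_arc l K j w"
            using e w by (intro piece_before_eq_curve_arc[OF v]) (auto simp: disjoint_iff)
          moreover have "f (piece_before l K (j, frac v)) = f (piece_after l K (j, frac v))"
            using v by (intro pass) (simp add: under_params_def)
          ultimately show ?thesis by (simp add: gv gw)
        qed
      next
        case False
        have "x \<notin> under_params l K j" if "x \<in> {min v w..max v w}" for x
        proof (cases "x = v")
          case False
          moreover have "\<bar>x - v\<bar> < e"
            using that w(2) by (auto simp: min_def max_def split: if_splits)
          ultimately show ?thesis by (rule e(2))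
        qed (use \<open>v \<notin> under_params l K j\<close> in simp)
        then have "curve_arc l K j v = curve_arc l K j w"
          by (intro curve_arc_cong) auto
        then show ?thesis using False gw by (simp add: g_def)
      qed
    qed
    then show ?thesis
      using e(1) by (auto simp: eventually_at dist_real_def)
  qed
  then have "g t = g u"
    by (intro connected_local_const[of UNIV]) auto
  then show ?thesis
    using t u by (simp add: g_def)
qed

text \<open>
  If the upper point of a crossing were also the lower point of another one, three points of the
  link at different heights would have the same projection.
\<close>

lemma over_point_not_under:
  assumes "link_diagram l K" "c \<in> crossings l K"
  shows "fst c \<in> link_points l - undercrossings l K"
proof -
  obtain p q where c: "c = (p, q)" by (cases c)
  have "p \<notin> undercrossings l K"
  proof
    assume "p \<in> undercrossings l K"
    then obtain p' where p': "(p', p) \<in> crossings l K" by (auto simp: undercrossings_def)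
    then have "p' = p \<or> p = q \<or> p' = q"
      using assms unfolding c link_diagram_def crossings_def by blast
    then show False
      using p' assms(2) by (auto simp: c crossings_def)
  qed
  then show ?thesis
    using assms(2) by (simp add: c crossings_def)
qed

lemma crossing_arcs:
  assumes D: "link_diagram l K" and c: "c \<in> crossings l K"
  shows "over_arc l K c \<in> arcs l K" "source_arc l K c \<in> arcs l K" "target_arc l K c \<in> arcs l K"
    "arc_component (target_arc l K c) = arc_component (source_arc l K c)"
proof -
  have fin: "finite (undercrossings l K)"
    using D by (simp add: link_diagram_def undercrossings_def)
  have q: "snd c \<in> undercrossings l K" using c by (simp add: undercrossings_def)
  show "over_arc l K c \<in> arcs l K"
    using over_point_not_under[OF D c] by (simp add: over_arc_def arcs_def)
  show "source_arc l K c \<in> arcs l K" "target_arc l K c \<in> arcs l K"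
    "arc_component (target_arc l K c) = arc_component (source_arc l K c)"
    using under_pieces[OF fin q] by (auto simp: source_arc_def target_arc_def)
qed

lemma arc_component_less:
  "A \<in> arcs l K \<Longrightarrow> arc_component A < l"
  by (auto simp: arcs_eq_curve_arcs arc_component_curve_arc)

section \<open>Integer matrices modulo n and the Smith normal form\<close>

lemma invertible_matE:
  assumes "invertible_mat P" "P \<in> carrier_mat k k"
  obtains P' where "P' \<in> carrier_mat k k" "P * P' = 1\<^sub>m k" "P' * P = 1\<^sub>m k"
proof -
  obtain P' where "P * P' = 1\<^sub>m k" "P' * P = 1\<^sub>m (dim_row P')"
    using assms by (auto simp: invertible_mat_def inverts_mat_def)
  moreover from this have "P' \<in> carrier_mat k k"
    using assms(2) by (metis carrier_matD(1,2) carrier_matI index_mult_mat(2,3) index_one_mat(2,3))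
  ultimately show thesis using that by auto
qed

lemma inverse_mult_mat_vec:
  fixes P P' :: "'a::comm_ring_1 mat"
  assumes "P \<in> carrier_mat k k" "P' \<in> carrier_mat k k" "P' * P = 1\<^sub>m k" "v \<in> carrier_vec k"
  shows "P' *\<^sub>v (P *\<^sub>v v) = v"
  using assoc_mult_mat_vec[OF assms(2,1,4)] one_mult_mat_vec[OF assms(4)]
  by (simp only: assms(3))

lemma mult3_mat_vec:
  fixes A P Q :: "'a::comm_ring_1 mat"
  assumes "P \<in> carrier_mat k k" "A \<in> carrier_mat k m" "Q \<in> carrier_mat m m" "v \<in> carrier_vec m"
  shows "(P * A * Q) *\<^sub>v v = P *\<^sub>v (A *\<^sub>v (Q *\<^sub>v v))"
proof -
  have "(P * A * Q) *\<^sub>v v = (P * A) *\<^sub>v (Q *\<^sub>v v)"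
    by (rule assoc_mult_mat_vec[of _ k m _ m]) (use assms in simp_all)
  also have "\<dots> = P *\<^sub>v (A *\<^sub>v (Q *\<^sub>v v))"
    by (rule assoc_mult_mat_vec[of _ k k _ m]) (use assms in simp_all)
  finally show ?thesis .
qed

definition diag_rect :: "nat \<Rightarrow> nat \<Rightarrow> 'a::zero list \<Rightarrow> 'a mat" where
  "diag_rect k m ds = mat k m (\<lambda>(i, j). if i = j \<and> i < length ds then ds ! i else 0)"

lemma diag_rect_mult_vec:
  fixes ds :: "'a::comm_ring_1 list"
  assumes "length ds \<le> m" "v \<in> carrier_vec m" "i < k"
  shows "(diag_rect k m ds *\<^sub>v v) $ i = (if i < length ds then ds ! i * v $ i else 0)"
proof -
  have "(diag_rect k m ds *\<^sub>v v) $ i = (\<Sum>j\<in>{0..<m}. diag_rect k m ds $$ (i, j) * v $ j)"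
    using assms(2,3) by (simp add: diag_rect_def scalar_prod_def)
  also have "\<dots> =
      (\<Sum>j\<in>{0..<m}. if i = j then (if i < length ds then ds ! i * v $ i else 0) else 0)"
    using assms(3) by (intro sum.cong HOL.refl) (auto simp: diag_rect_def)
  also have "\<dots> = (if i < length ds then ds ! i * v $ i else 0)"
    using assms by simp
  finally show ?thesis .
qed

lemma diag_rect_carrier: "diag_rect k m ds \<in> carrier_mat k m"
  by (simp add: diag_rect_def)

lemma rank_eq_of_col_space_eq:
  fixes A B :: "'a::field mat"
  assumes "A \<in> carrier_mat k m" "B \<in> carrier_mat k m'"
    and "{A *\<^sub>v x |x. x \<in> carrier_vec m} = {B *\<^sub>v x |x. x \<in> carrier_vec m'}"
  shows "vec_space.rank k A = vec_space.rank k B"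
proof -
  interpret vec_space "TYPE('a)" k .
  have "col_space X = {X *\<^sub>v x |x. x \<in> carrier_vec m}" if "X \<in> carrier_mat k m" for X m
    using that by (auto simp: col_space_eq[OF that])
  from this[OF assms(1)] this[OF assms(2)] have "col_space A = col_space B"
    using assms(3) by simp
  then show ?thesis by (simp add: rank_def col_space_def)
qed

text \<open>
  Since \<open>A Q = P\<^sup>-\<^sup>1 D\<close> with \<open>Q\<close> invertible, \<open>A\<close> has the image of \<open>P\<^sup>-\<^sup>1 D\<close>, and this is spanned
  by the columns of \<open>P\<^sup>-\<^sup>1\<close> that meet a nonzero diagonal entry. Those are linearly independent,
  being columns of an invertible matrix.
\<close>

lemma rank_diag_equivalent:
  fixes A P Q :: "'a::field mat"
  assumes A: "A \<in> carrier_mat k m" and P: "P \<in> carrier_mat k k" and P': "P' \<in> carrier_mat k k"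
    and Q: "Q \<in> carrier_mat m m" and Q': "Q' \<in> carrier_mat m m"
    and inv: "P' * P = 1\<^sub>m k" "Q * Q' = 1\<^sub>m m" "Q' * Q = 1\<^sub>m m"
    and D: "P * A * Q = diag_rect k m ds" and ds: "length ds \<le> k" "length ds \<le> m"
    and nz: "\<forall>i<length ds. ds ! i \<noteq> 0"
  shows "vec_space.rank k A = length ds"
proof -
  interpret vec_space "TYPE('a)" k .
  let ?s = "length ds"
  define B where "B = mat_of_cols k (take ?s (cols P'))"
  have "det P' * det P = 1"
    using det_mult[OF P' P] inv(1) by simp
  then have rank: "rank P' = k"
    by (intro low_rank_det_zero[OF P']) auto
  then have dist: "distinct (cols P')"
    using non_distinct_low_rank[OF P'] by auto
  then have indpt: "lin_indpt (set (cols P'))"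
    using full_rank_lin_indpt[OF P' rank] by simp
  have colsP': "set (cols P') \<subseteq> carrier_vec k" using cols_dim[of P'] P' by simp
  have "length (take ?s (cols P')) = ?s"
    using ds P' by simp
  then have Bc: "B \<in> carrier_mat k ?s"
    unfolding B_def by (metis mat_of_cols_carrier(1))
  have colsB: "cols B = take ?s (cols P')"
    unfolding B_def using colsP' by (intro cols_mat_of_cols) (auto dest: in_set_takeD)
  have "rank B = ?s"
  proof (rule lin_indpt_full_rank[OF Bc])
    show "distinct (cols B)" using dist by (simp add: colsB)
    show "lin_indpt (set (cols B))"
      by (rule subset_li_is_li[OF indpt]) (auto simp: colsB dest: in_set_takeD)
  qed
  moreover have "rank A = rank B"
  proof (rule rank_eq_of_col_space_eq[OF A Bc])
    \<comment> \<open>Multiplying by \<open>B\<close> is padding with zeros, followed by \<open>P'\<close>.\<close>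
    have Bz: "B *\<^sub>v z = P' *\<^sub>v vec k (\<lambda>i. if i < ?s then z $ i else 0)" if "z \<in> carrier_vec ?s" for z
    proof (rule eq_vecI)
      fix i assume "i < dim_vec (P' *\<^sub>v vec k (\<lambda>i. if i < ?s then z $ i else 0))"
      then have i: "i < k" using P' by simp
      have "(B *\<^sub>v z) $ i = (\<Sum>j\<in>{0..<?s}. P' $$ (i, j) * z $ j)"
        using i that Bc P' ds
        by (auto simp: scalar_prod_def B_def mat_of_cols_index intro!: sum.cong)
      also have "\<dots> = (\<Sum>j\<in>{0..<k}. P' $$ (i, j) * (if j < ?s then z $ j else 0))"
        using ds by (intro sum.mono_neutral_cong_left) auto
      also have "\<dots> = (P' *\<^sub>v vec k (\<lambda>i. if i < ?s then z $ i else 0)) $ i"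
        using i P' by (auto simp: scalar_prod_def intro!: sum.cong)
      finally show "(B *\<^sub>v z) $ i = (P' *\<^sub>v vec k (\<lambda>i. if i < ?s then z $ i else 0)) $ i" .
    qed (use Bc P' in auto)
    have AQ: "A *\<^sub>v (Q *\<^sub>v y) = P' *\<^sub>v (diag_rect k m ds *\<^sub>v y)" if y: "y \<in> carrier_vec m" for y
    proof -
      have "diag_rect k m ds *\<^sub>v y = P *\<^sub>v (A *\<^sub>v (Q *\<^sub>v y))"
        unfolding D[symmetric] by (rule mult3_mat_vec[OF P A Q y])
      also have "P' *\<^sub>v \<dots> = A *\<^sub>v (Q *\<^sub>v y)"
        using y A P P' Q inv by (intro inverse_mult_mat_vec) auto
      finally show ?thesis by simp
    qed
    have Dz: "diag_rect k m ds *\<^sub>v y = vec k (\<lambda>i. if i < ?s then z $ i else 0)"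
      if "y \<in> carrier_vec m" "\<And>i. i < ?s \<Longrightarrow> z $ i = ds ! i * y $ i" for y z
      using that ds
      by (intro eq_vecI)
        (auto simp: diag_rect_mult_vec carrier_matD[OF diag_rect_carrier] simp del: index_mult_mat_vec)
    show "{A *\<^sub>v x |x. x \<in> carrier_vec m} = {B *\<^sub>v x |x. x \<in> carrier_vec ?s}"
    proof (intro equalityI subsetI)
      fix w assume "w \<in> {A *\<^sub>v x |x. x \<in> carrier_vec m}"
      then obtain x where x: "x \<in> carrier_vec m" "w = A *\<^sub>v x" by blast
      define z where "z = vec ?s (\<lambda>i. ds ! i * (Q' *\<^sub>v x) $ i)"
      have "Q *\<^sub>v (Q' *\<^sub>v x) = x"
        using x Q Q' inv by (intro inverse_mult_mat_vec)
      then have "w = P' *\<^sub>v (diag_rect k m ds *\<^sub>v (Q' *\<^sub>v x))"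
        using x Q' AQ[of "Q' *\<^sub>v x"] by simp
      also have "diag_rect k m ds *\<^sub>v (Q' *\<^sub>v x) = vec k (\<lambda>i. if i < ?s then z $ i else 0)"
        using x Q' by (intro Dz) (auto simp: z_def)
      also have "P' *\<^sub>v \<dots> = B *\<^sub>v z"
        by (rule Bz[symmetric]) (simp add: z_def)
      finally show "w \<in> {B *\<^sub>v x |x. x \<in> carrier_vec ?s}" by (auto simp: z_def)
    next
      fix w assume "w \<in> {B *\<^sub>v x |x. x \<in> carrier_vec ?s}"
      then obtain z where z: "z \<in> carrier_vec ?s" "w = B *\<^sub>v z" by blast
      define y where "y = vec m (\<lambda>i. if i < ?s then z $ i / ds ! i else 0)"
      have y: "y \<in> carrier_vec m" by (simp add: y_def)
      have "diag_rect k m ds *\<^sub>v y = vec k (\<lambda>i. if i < ?s then z $ i else 0)"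
        using nz ds by (intro Dz) (auto simp: y_def)
      then have "w = A *\<^sub>v (Q *\<^sub>v y)"
        using z by (simp add: AQ[OF y] Bz)
      then show "w \<in> {A *\<^sub>v x |x. x \<in> carrier_vec m}"
        using Q y by auto
    qed
  qed
  ultimately show ?thesis by simp
qed

text \<open>
  The kernel of \<open>A\<close> on \<open>(\<int>/n)\<^sup>m\<close>, with residue classes given by their representatives in
  \<open>{0..<n}\<close>.
\<close>

definition mod_kernel :: "nat \<Rightarrow> int mat \<Rightarrow> int vec set" where
  "mod_kernel n A = {v \<in> carrier_vec (dim_col A). (\<forall>j<dim_col A. v $ j \<in> {0..<int n}) \<and>
     (\<forall>i<dim_row A. int n dvd (A *\<^sub>v v) $ i)}"

definition vec_mod :: "int vec \<Rightarrow> nat \<Rightarrow> int vec" where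
  "vec_mod v n = vec (dim_vec v) (\<lambda>i. v $ i mod int n)"

definition vec_cong :: "nat \<Rightarrow> int vec \<Rightarrow> int vec \<Rightarrow> bool" where
  "vec_cong n v w \<longleftrightarrow> dim_vec v = dim_vec w \<and> (\<forall>i<dim_vec v. int n dvd v $ i - w $ i)"

lemma vec_cong_mult:
  assumes "A \<in> carrier_mat k m" "v \<in> carrier_vec m" "w \<in> carrier_vec m" "vec_cong n v w"
  shows "vec_cong n (A *\<^sub>v v) (A *\<^sub>v w)"
  unfolding vec_cong_def
proof (intro conjI allI impI)
  fix i assume "i < dim_vec (A *\<^sub>v v)"
  then have "(A *\<^sub>v v) $ i - (A *\<^sub>v w) $ i = (\<Sum>j\<in>{0..<m}. A $$ (i, j) * (v $ j - w $ j))"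
    using assms by (simp add: scalar_prod_def sum_subtractf right_diff_distrib)
  also have "int n dvd \<dots>"
    using assms by (intro dvd_sum dvd_mult) (auto simp: vec_cong_def)
  finally show "int n dvd (A *\<^sub>v v) $ i - (A *\<^sub>v w) $ i" .
qed simp

lemma vec_cong_trans:
  assumes "vec_cong n u v" "vec_cong n v w"
  shows "vec_cong n u w"
  unfolding vec_cong_def
proof (intro conjI allI impI)
  fix i assume "i < dim_vec u"
  then have "int n dvd (u $ i - v $ i) + (v $ i - w $ i)"
    using assms by (intro dvd_add) (auto simp: vec_cong_def)
  then show "int n dvd u $ i - w $ i" by simp
qed (use assms in \<open>simp add: vec_cong_def\<close>)

lemma vec_cong_mod: "vec_cong n (vec_mod v n) v"
proof -
  have "int n dvd x mod int n - x" for x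
    by (metis mod_eq_dvd_iff mod_mod_trivial)
  then show ?thesis by (auto simp: vec_cong_def vec_mod_def)
qed

lemma vec_mod_eq:
  assumes "vec_cong n v w" "\<forall>j<dim_vec w. w $ j \<in> {0..<int n}"
  shows "vec_mod v n = w"
proof (rule eq_vecI)
  fix j assume j: "j < dim_vec w"
  then have "v $ j mod int n = w $ j mod int n"
    using assms(1) by (simp add: vec_cong_def mod_eq_dvd_iff)
  then show "vec_mod v n $ j = w $ j"
    using assms j by (simp add: vec_cong_def vec_mod_def)
qed (use assms(1) in \<open>simp add: vec_cong_def vec_mod_def\<close>)

lemma mod_kernel_iff:
  assumes "A \<in> carrier_mat k m"
  shows "v \<in> mod_kernel n A \<longleftrightarrow> v \<in> carrier_vec m \<and> (\<forall>j<m. v $ j \<in> {0..<int n}) \<and>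
    vec_cong n (A *\<^sub>v v) (0\<^sub>v k)"
  using assms by (auto simp: mod_kernel_def vec_cong_def)

lemma vec_cong_zero_mult:
  assumes "A \<in> carrier_mat k m" "v \<in> carrier_vec m" "vec_cong n v (0\<^sub>v m)"
  shows "vec_cong n (A *\<^sub>v v) (0\<^sub>v k)"
proof -
  have "A *\<^sub>v 0\<^sub>v m = 0\<^sub>v k" using assms(1) by auto
  then show ?thesis using vec_cong_mult[OF assms(1,2) _ assms(3)] by simp
qed

text \<open>
  The substitution \<open>v = Q y\<close> is a bijection modulo \<open>n\<close>, and \<open>P\<close>, being invertible over the
  integers, neither creates nor destroys zeros modulo \<open>n\<close>.
\<close>

lemma card_mod_kernel_equivalent:
  assumes n: "n > 0" and A: "A \<in> carrier_mat k m" and P: "P \<in> carrier_mat k k" and P': "P' \<in> carrier_mat k k"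
    and Q: "Q \<in> carrier_mat m m" and Q': "Q' \<in> carrier_mat m m"
    and inv: "P' * P = 1\<^sub>m k" "Q * Q' = 1\<^sub>m m" "Q' * Q = 1\<^sub>m m"
  shows "card (mod_kernel n (P * A * Q)) = card (mod_kernel n A)"
proof -
  have PAQ: "P * A * Q \<in> carrier_mat k m" using A P Q by simp
  have PAQ_vec: "(P * A * Q) *\<^sub>v y = P *\<^sub>v (A *\<^sub>v (Q *\<^sub>v y))" if "y \<in> carrier_vec m" for y
    using that by (rule mult3_mat_vec[OF P A Q])
  have QQ: "Q *\<^sub>v (Q' *\<^sub>v x) = x" "Q' *\<^sub>v (Q *\<^sub>v x) = x" if "x \<in> carrier_vec m" for x
    using inverse_mult_mat_vec[OF Q' Q inv(2) that] inverse_mult_mat_vec[OF Q Q' inv(3) that] by auto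
  have PP: "P' *\<^sub>v (P *\<^sub>v x) = x" if "x \<in> carrier_vec k" for x
    using that by (rule inverse_mult_mat_vec[OF P P' inv(1)])
  have modc: "vec_mod v n \<in> carrier_vec m" if "v \<in> carrier_vec m" for v
    using carrier_vecD[OF that] by (intro carrier_vecI) (simp add: vec_mod_def)
  have range: "\<forall>j<m. vec_mod v n $ j \<in> {0..<int n}" if "v \<in> carrier_vec m" for v
    using carrier_vecD[OF that] n by (simp add: vec_mod_def)
  have "bij_betw (\<lambda>y. vec_mod (Q *\<^sub>v y) n) (mod_kernel n (P * A * Q)) (mod_kernel n A)"
  proof (rule bij_betw_byWitness[where f' = "\<lambda>x. vec_mod (Q' *\<^sub>v x) n"])
    show "\<forall>y\<in>mod_kernel n (P * A * Q). vec_mod (Q' *\<^sub>v vec_mod (Q *\<^sub>v y) n) n = y"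
    proof
      fix y assume "y \<in> mod_kernel n (P * A * Q)"
      then have y: "y \<in> carrier_vec m" "\<forall>j<m. y $ j \<in> {0..<int n}"
        by (simp_all add: mod_kernel_iff[OF PAQ])
      have "vec_cong n (Q' *\<^sub>v vec_mod (Q *\<^sub>v y) n) (Q' *\<^sub>v (Q *\<^sub>v y))"
        using y Q by (intro vec_cong_mult[OF Q'] vec_cong_mod modc) auto
      then show "vec_mod (Q' *\<^sub>v vec_mod (Q *\<^sub>v y) n) n = y"
        using y by (intro vec_mod_eq) (auto simp: QQ)
    qed
    show "\<forall>x\<in>mod_kernel n A. vec_mod (Q *\<^sub>v vec_mod (Q' *\<^sub>v x) n) n = x"
    proof
      fix x assume "x \<in> mod_kernel n A"
      then have x: "x \<in> carrier_vec m" "\<forall>j<m. x $ j \<in> {0..<int n}"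
        by (simp_all add: mod_kernel_iff[OF A])
      have "vec_cong n (Q *\<^sub>v vec_mod (Q' *\<^sub>v x) n) (Q *\<^sub>v (Q' *\<^sub>v x))"
        using x Q' by (intro vec_cong_mult[OF Q] vec_cong_mod modc) auto
      then show "vec_mod (Q *\<^sub>v vec_mod (Q' *\<^sub>v x) n) n = x"
        using x by (intro vec_mod_eq) (auto simp: QQ)
    qed
    show "(\<lambda>y. vec_mod (Q *\<^sub>v y) n) ` mod_kernel n (P * A * Q) \<subseteq> mod_kernel n A"
    proof (rule image_subsetI)
      fix y assume "y \<in> mod_kernel n (P * A * Q)"
      then have y: "y \<in> carrier_vec m" and 1: "vec_cong n (P *\<^sub>v (A *\<^sub>v (Q *\<^sub>v y))) (0\<^sub>v k)"
        by (auto simp: mod_kernel_iff[OF PAQ] PAQ_vec)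
      have Qy: "Q *\<^sub>v y \<in> carrier_vec m" using Q y by simp
      have "vec_cong n (P' *\<^sub>v (P *\<^sub>v (A *\<^sub>v (Q *\<^sub>v y)))) (0\<^sub>v k)"
        using 1 A P Qy by (intro vec_cong_zero_mult[OF P']) auto
      then have "vec_cong n (A *\<^sub>v (Q *\<^sub>v y)) (0\<^sub>v k)"
        using A Qy by (simp add: PP)
      moreover have "vec_cong n (A *\<^sub>v vec_mod (Q *\<^sub>v y) n) (A *\<^sub>v (Q *\<^sub>v y))"
        by (intro vec_cong_mult[OF A] vec_cong_mod modc Qy)
      ultimately have "vec_cong n (A *\<^sub>v vec_mod (Q *\<^sub>v y) n) (0\<^sub>v k)"
        using vec_cong_trans by blast
      then show "vec_mod (Q *\<^sub>v y) n \<in> mod_kernel n A"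
        using modc[OF Qy] range[OF Qy] by (simp add: mod_kernel_iff[OF A])
    qed
    show "(\<lambda>x. vec_mod (Q' *\<^sub>v x) n) ` mod_kernel n A \<subseteq> mod_kernel n (P * A * Q)"
    proof (rule image_subsetI)
      fix x assume "x \<in> mod_kernel n A"
      then have x: "x \<in> carrier_vec m" and 1: "vec_cong n (A *\<^sub>v x) (0\<^sub>v k)"
        by (auto simp: mod_kernel_iff[OF A])
      have Qx: "Q' *\<^sub>v x \<in> carrier_vec m" using Q' x by simp
      have "vec_cong n (P *\<^sub>v (A *\<^sub>v x)) (0\<^sub>v k)"
        using 1 A x by (intro vec_cong_zero_mult[OF P]) auto
      then have "vec_cong n ((P * A * Q) *\<^sub>v (Q' *\<^sub>v x)) (0\<^sub>v k)"
        using x by (simp add: PAQ_vec[OF Qx] QQ)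
      moreover have "vec_cong n ((P * A * Q) *\<^sub>v vec_mod (Q' *\<^sub>v x) n) ((P * A * Q) *\<^sub>v (Q' *\<^sub>v x))"
        by (intro vec_cong_mult[OF PAQ] vec_cong_mod modc Qx)
      ultimately have "vec_cong n ((P * A * Q) *\<^sub>v vec_mod (Q' *\<^sub>v x) n) (0\<^sub>v k)"
        using vec_cong_trans by blast
      then show "vec_mod (Q' *\<^sub>v x) n \<in> mod_kernel n (P * A * Q)"
        using modc[OF Qx] range[OF Qx] by (simp add: mod_kernel_iff[OF PAQ])
    qed
  qed
  then show ?thesis by (rule bij_betw_same_card)
qed

text \<open>
  With \<open>g = gcd d n\<close> the condition says that \<open>x\<close> is a multiple of \<open>n / g\<close>, and \<open>g\<close> such multiples
  lie below \<open>n\<close>.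
\<close>

lemma card_dvd_mult:
  assumes "n > 0"
  shows "card {x \<in> {0..<int n}. int n dvd int d * x} = gcd d n"
proof -
  define g where "g = gcd d n"
  define q where "q = n div g"
  have g: "g > 0" using assms by (simp add: g_def)
  have n: "n = q * g" by (simp add: q_def g_def)
  then have q: "q > 0" using assms by (cases q) auto
  have dvd_iff: "int n dvd int d * x \<longleftrightarrow> int q dvd x" for x
  proof -
    have d: "d = (d div g) * g" by (simp add: g_def)
    have "coprime q (d div g)"
      using div_gcd_coprime[of d n] assms by (simp add: q_def g_def coprime_commute)
    then have cop: "coprime (int q) (int (d div g))" by simp
    have "int n dvd int d * x \<longleftrightarrow> int g * int q dvd int g * (int (d div g) * x)"
      by (subst d, subst n) (simp add: mult_ac)
    also have "\<dots> \<longleftrightarrow> int q dvd int (d div g) * x" using g by simp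
    also have "\<dots> \<longleftrightarrow> int q dvd x" using cop by (rule coprime_dvd_mult_right_iff)
    finally show ?thesis .
  qed
  have "{x \<in> {0..<int n}. int n dvd int d * x} = (\<lambda>i. int q * i) ` {0..<int g}"
  proof (intro equalityI subsetI)
    fix x assume "x \<in> {x \<in> {0..<int n}. int n dvd int d * x}"
    then obtain i where "x = int q * i" "0 \<le> x" "x < int n" by (auto simp: dvd_iff)
    moreover from this have "i \<in> {0..<int g}"
      using q by (auto simp: n zero_le_mult_iff)
    ultimately show "x \<in> (\<lambda>i. int q * i) ` {0..<int g}" by blast
  next
    fix x assume "x \<in> (\<lambda>i. int q * i) ` {0..<int g}"
    then obtain i where "i \<in> {0..<int g}" and i: "x = int q * i" by blast
    then have "0 \<le> x" "x < int n" using q by (simp_all add: n)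
    then show "x \<in> {x \<in> {0..<int n}. int n dvd int d * x}"
      using i by (simp add: dvd_iff)
  qed
  moreover have "inj_on (\<lambda>i. int q * i) {0..<int g}"
    using q by (auto intro: inj_onI)
  ultimately show ?thesis by (simp add: card_image g_def)
qed

text \<open>
  The system is decoupled: coordinate \<open>i\<close> has \<open>gcd (ds ! i) n\<close> admissible values for
  \<open>i < length ds\<close>, and otherwise is free.
\<close>

lemma card_mod_kernel_diag:
  assumes "n > 0" "length ds \<le> k" "length ds \<le> m"
  shows "card (mod_kernel n (diag_rect k m (map int ds))) =
    n ^ (m - length ds) * (\<Prod>i<length ds. gcd (ds ! i) n)"
proof -
  let ?S = "\<lambda>i. {x \<in> {0..<int n}. i < length ds \<longrightarrow> int n dvd int (ds ! i) * x}"
  let ?D = "diag_rect k m (map int ds)"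
  have "bij_betw (\<lambda>x. vec m x) (PiE {..<m} ?S) (mod_kernel n ?D)"
  proof (rule bij_betw_imageI)
    show "inj_on (vec m) (PiE {..<m} ?S)"
    proof (rule inj_onI)
      fix x y assume xy: "x \<in> PiE {..<m} ?S" "y \<in> PiE {..<m} ?S" "vec m x = vec m y"
      then have "x i = y i" if "i < m" for i using that by (metis index_vec)
      with xy(1,2) show "x = y" by (intro PiE_ext) auto
    qed
    have in_kernel: "v \<in> mod_kernel n ?D \<longleftrightarrow> v \<in> carrier_vec m \<and> (\<forall>i<m. v $ i \<in> ?S i)" for v
    proof -
      have "(\<forall>i<k. int n dvd (?D *\<^sub>v v) $ i) \<longleftrightarrow>
          (\<forall>i<m. i < length ds \<longrightarrow> int n dvd int (ds ! i) * v $ i)" if "v \<in> carrier_vec m"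
        using that assms by (auto simp: diag_rect_mult_vec simp del: index_mult_mat_vec)
      then show ?thesis
        by (auto simp: mod_kernel_def carrier_matD[OF diag_rect_carrier] simp del: index_mult_mat_vec)
    qed
    show "vec m ` PiE {..<m} ?S = mod_kernel n ?D"
    proof (intro equalityI subsetI)
      fix v assume v: "v \<in> mod_kernel n ?D"
      then have "v = vec m (\<lambda>i\<in>{..<m}. v $ i)" by (auto simp: in_kernel)
      moreover have "(\<lambda>i\<in>{..<m}. v $ i) \<in> PiE {..<m} ?S" using v by (auto simp: in_kernel)
      ultimately show "v \<in> vec m ` PiE {..<m} ?S" by blast
    next
      fix v assume "v \<in> vec m ` PiE {..<m} ?S"
      then obtain x where "v = vec m x" "x \<in> PiE {..<m} ?S" by blast
      moreover from \<open>x \<in> PiE {..<m} ?S\<close> have "x i \<in> ?S i" if "i < m" for i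
        using PiE_mem[OF \<open>x \<in> PiE {..<m} ?S\<close>, of i] that by simp
      ultimately show "v \<in> mod_kernel n ?D"
        unfolding in_kernel by simp
    qed
  qed
  from bij_betw_same_card[OF this] have "card (mod_kernel n ?D) = card (PiE {..<m} ?S)"
    by (rule HOL.sym)
  also have "\<dots> = (\<Prod>i<m. card (?S i))"
    by (rule card_PiE) simp
  also have "\<dots> = (\<Prod>i<length ds. card (?S i)) * (\<Prod>i\<in>{length ds..<m}. card (?S i))"
    using prod.atLeastLessThan_concat[OF le0 assms(3), of "\<lambda>i. card (?S i)"]
    by (simp only: lessThan_atLeast0)
  also have "(\<Prod>i<length ds. card (?S i)) = (\<Prod>i<length ds. gcd (ds ! i) n)"
  proof (intro prod.cong HOL.refl)
    fix i assume "i \<in> {..<length ds}"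
    then show "card (?S i) = gcd (ds ! i) n"
      using card_dvd_mult[OF assms(1), of "ds ! i"] by simp
  qed
  also have "(\<Prod>i\<in>{length ds..<m}. card (?S i)) = (\<Prod>i\<in>{length ds..<m}. n)"
  proof (intro prod.cong HOL.refl)
    fix i assume "i \<in> {length ds..<m}"
    then have "?S i = {0..<int n}" by auto
    then show "card (?S i) = n" by simp
  qed
  also have "\<dots> = n ^ (m - length ds)"
    by simp
  finally show ?thesis by (simp add: mult.commute)
qed

lemma smith_rank_and_kernel:
  assumes "smith_entries A ds" "n > 0"
  shows "int_mat_rank A = length ds"
    and "card (mod_kernel n A) =
      n ^ (dim_col A - length ds) * (\<Prod>i<length ds. gcd (ds ! i) n)"
proof -
  let ?k = "dim_row A" and ?m = "dim_col A" and ?D = "diag_rect (dim_row A) (dim_col A) (map int ds)"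
  have A: "A \<in> carrier_mat ?k ?m" by simp
  obtain P Q where P: "P \<in> carrier_mat ?k ?k" "invertible_mat P"
    and Q: "Q \<in> carrier_mat ?m ?m" "invertible_mat Q"
    and "P * A * Q = mat ?k ?m (\<lambda>(i, j). if i = j \<and> i < length ds then int (ds ! i) else 0)"
    and ds: "length ds \<le> ?k" "length ds \<le> ?m" and pos: "\<forall>i<length ds. ds ! i > 0"
    using assms(1) by (auto simp: smith_entries_def)
  then have D: "P * A * Q = ?D"
    by (auto simp: diag_rect_def intro!: eq_matI)
  obtain P' where P': "P' \<in> carrier_mat ?k ?k" "P * P' = 1\<^sub>m ?k" "P' * P = 1\<^sub>m ?k"
    using invertible_matE[OF P(2,1)] .
  obtain Q' where Q': "Q' \<in> carrier_mat ?m ?m" "Q * Q' = 1\<^sub>m ?m" "Q' * Q = 1\<^sub>m ?m"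
    using invertible_matE[OF Q(2,1)] .
  show "card (mod_kernel n A) = n ^ (?m - length ds) * (\<Prod>i<length ds. gcd (ds ! i) n)"
    using card_mod_kernel_equivalent[OF assms(2) A P(1) P'(1) Q(1) Q'(1) P'(3) Q'(2,3)]
      card_mod_kernel_diag[OF assms(2) ds] by (simp add: D)
  let ?h = "map_mat rat_of_int"
  have "?h P * ?h A * ?h Q = ?h (P * A * Q)"
    using A P(1) Q(1) by (simp add: of_int_hom.mat_hom_mult[of _ ?k ?k _ ?m] of_int_hom.mat_hom_mult[of _ ?k ?m _ ?m])
  also have "\<dots> = diag_rect ?k ?m (map rat_of_int (map int ds))"
    by (auto simp: D diag_rect_def intro!: eq_matI)
  finally have hD: "?h P * ?h A * ?h Q = diag_rect ?k ?m (map rat_of_int (map int ds))" .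
  have hinv: "?h X * ?h Y = 1\<^sub>m k" if "X \<in> carrier_mat k k" "Y \<in> carrier_mat k k" "X * Y = 1\<^sub>m k" for X Y k
  proof -
    have "?h X * ?h Y = ?h (X * Y)"
      by (rule of_int_hom.mat_hom_mult[OF that(1,2), symmetric])
    then show ?thesis by (simp only: that(3) of_int_hom.mat_hom_one)
  qed
  have "vec_space.rank ?k (?h A) = length (map rat_of_int (map int ds))"
  proof (rule rank_diag_equivalent)
    show "?h P * ?h A * ?h Q = diag_rect ?k ?m (map rat_of_int (map int ds))" by (rule hD)
    show "?h P' * ?h P = 1\<^sub>m ?k" by (rule hinv[OF P'(1) P(1) P'(3)])
    show "?h Q * ?h Q' = 1\<^sub>m ?m" by (rule hinv[OF Q(1) Q'(1,2)])
    show "?h Q' * ?h Q = 1\<^sub>m ?m" by (rule hinv[OF Q'(1) Q(1) Q'(3)])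
    show "\<forall>i<length (map rat_of_int (map int ds)). map rat_of_int (map int ds) ! i \<noteq> 0"
      using pos by auto
  qed (use P P' Q Q' ds in simp_all)
  then show "int_mat_rank A = length ds"
    by (simp add: int_mat_rank_def)
qed

section \<open>Dihedral colorings of a diagram\<close>

definition arc_colorings ::
  "nat \<Rightarrow> (nat \<Rightarrow> real \<Rightarrow> complex \<times> real) \<Rightarrow> ('b, 'c) quandle_scheme \<Rightarrow> (link_point set \<Rightarrow> 'b) set" where
  "arc_colorings l K T = {g \<in> arcs l K \<rightarrow>\<^sub>E carrier T. \<forall>c\<in>crossings l K.
     g (target_arc l K c) = g (source_arc l K c) \<triangleright>\<^bsub>T\<^esub> g (over_arc l K c)}"

lemma card_qnd_hom_fundamental_quandle:
  assumes "link_diagram l K" "is_quandle T"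
  shows "card (qnd_hom (fundamental_quandle l K) T) = card (arc_colorings l K T)"
proof -
  let ?R = "(\<lambda>c. (QGen (target_arc l K c), QOp (QGen (source_arc l K c)) (QGen (over_arc l K c))))
    ` crossings l K"
  have "arc_colorings l K T = {g \<in> arcs l K \<rightarrow>\<^sub>E carrier T.
      \<forall>(s, t)\<in>?R. s \<in> qterms (arcs l K) \<longrightarrow> t \<in> qterms (arcs l K) \<longrightarrow>
        qterm_eval T g s = qterm_eval T g t}"
    using crossing_arcs[OF assms(1)]
    by (auto simp: arc_colorings_def qterms.gen qterms.op)
  then show ?thesis
    using bij_betw_same_card[OF qnd_hom_presented_bij[OF assms(2), of "arcs l K" ?R]]
    by (simp add: fundamental_quandle_def)
qed

definition crossing_solutions ::
  "nat \<Rightarrow> (nat \<Rightarrow> real \<Rightarrow> complex \<times> real) \<Rightarrow> nat \<Rightarrow> (nat \<Rightarrow> nat) \<Rightarrow> (link_point set \<Rightarrow> int) set" where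
  "crossing_solutions l K n \<tau> = {x \<in> arcs l K \<rightarrow>\<^sub>E {0..<int n}. \<forall>c\<in>crossings l K.
     int n dvd 2 * int (arc_type \<tau> (source_arc l K c)) * x (over_arc l K c) +
       (- 1) ^ arc_type \<tau> (over_arc l K c) * x (source_arc l K c) - x (target_arc l K c)}"

lemma arc_type_cases:
  assumes "\<tau> \<in> signatures l" "A \<in> arcs l K"
  shows "arc_type \<tau> A \<in> {0, 1}"
  using arc_component_less[OF assms(2)] assms(1)
  by (auto simp: signatures_def arc_type_def dest!: PiE_mem)

lemma eq_if_dvd_diff:
  assumes "x \<in> {0..<int n}" "y \<in> {0..<int n}" "int n dvd x - y"
  shows "x = y"
  using assms by (metis atLeastLessThan_iff mod_eq_dvd_iff mod_pos_pos_trivial)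

lemma coloring_crossing_iff:
  assumes D: "link_diagram l K" and n: "n > 0" and c: "c \<in> crossings l K"
    and e: "\<And>A. A \<in> arcs l K \<Longrightarrow> e A \<in> {0, 1}"
  shows "dihedral_elem n (e (target_arc l K c)) (x (target_arc l K c)) =
      dihedral_elem n (e (source_arc l K c)) (x (source_arc l K c)) \<triangleright>\<^bsub>Conj (dihedral n)\<^esub>
      dihedral_elem n (e (over_arc l K c)) (x (over_arc l K c)) \<longleftrightarrow>
    e (target_arc l K c) = e (source_arc l K c) \<and>
    int n dvd 2 * int (e (source_arc l K c)) * x (over_arc l K c) +
       (- 1) ^ e (over_arc l K c) * x (source_arc l K c) - x (target_arc l K c)"
  unfolding dihedral_elem_conj[OF e[OF crossing_arcs(1)[OF D c]] e[OF crossing_arcs(2)[OF D c]]]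
    dihedral_elem_eq_iff[OF n e[OF crossing_arcs(3)[OF D c]] e[OF crossing_arcs(2)[OF D c]]]
  by (subst dvd_diff_commute) (rule HOL.refl)

text \<open>
  A coloring by \<open>s\<^sup>e r\<^sup>x\<close> is the same as a component signature together with a solution of its
  linear system. The relation at a crossing forces both under-arcs into the same coset, so the
  coset is the same along a whole component; as every component has an arc, the signature can be
  recovered from the coloring.
\<close>

lemma coloring_bij:
  assumes D: "link_diagram l K" and n: "n > 0"
  shows "bij_betw (\<lambda>(\<tau>, x). \<lambda>A\<in>arcs l K. dihedral_elem n (arc_type \<tau> A) (x A))
    (Sigma (signatures l) (crossing_solutions l K n)) (arc_colorings l K (Conj (dihedral n)))"
proof (rule bij_betw_imageI)
  let ?F = "\<lambda>(\<tau>, x). \<lambda>A\<in>arcs l K. dihedral_elem n (arc_type \<tau> A) (x A)"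
  let ?S = "Sigma (signatures l) (crossing_solutions l K n)"
  have fin: "finite (undercrossings l K)"
    using D by (simp add: link_diagram_def undercrossings_def)
  have carT: "carrier (Conj (dihedral n)) = carrier (dihedral n)"
    by (simp add: Conj_def)
  show "inj_on ?F ?S"
  proof (rule inj_onI)
    fix p p' assume pS: "p \<in> ?S" "p' \<in> ?S" and eq: "?F p = ?F p'"
    obtain \<tau> x \<sigma> y where p: "p = (\<tau>, x)" "p' = (\<sigma>, y)" by (cases p, cases p')
    have sig: "\<tau> \<in> signatures l" "\<sigma> \<in> signatures l"
      and xy: "x \<in> arcs l K \<rightarrow>\<^sub>E {0..<int n}" "y \<in> arcs l K \<rightarrow>\<^sub>E {0..<int n}"
      using pS by (auto simp: p crossing_solutions_def)
    have *: "arc_type \<tau> A = arc_type \<sigma> A \<and> x A = y A" if A: "A \<in> arcs l K" for A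
    proof -
      have "dihedral_elem n (arc_type \<tau> A) (x A) = dihedral_elem n (arc_type \<sigma> A) (y A)"
        using fun_cong[OF eq, of A] A by (simp add: p)
      then have "arc_type \<tau> A = arc_type \<sigma> A" "int n dvd x A - y A"
        using dihedral_elem_eq_iff[OF n arc_type_cases[OF sig(1) A] arc_type_cases[OF sig(2) A]]
        by auto
      then show ?thesis
        using eq_if_dvd_diff[OF PiE_mem[OF xy(1) A] PiE_mem[OF xy(2) A]] by simp
    qed
    have "x = y" using xy * by (intro PiE_ext) auto
    moreover have "\<tau> j = \<sigma> j" if "j < l" for j
      using exists_arc[OF fin that] * by (auto simp: arc_type_def)
    then have "\<tau> = \<sigma>" using sig unfolding signatures_def by (intro PiE_ext) auto
    ultimately show "p = p'" by (simp add: p)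
  qed
  show "?F ` ?S = arc_colorings l K (Conj (dihedral n))"
  proof (intro equalityI subsetI)
    fix g assume "g \<in> ?F ` ?S"
    then obtain \<tau> x where \<tau>: "\<tau> \<in> signatures l" and x: "x \<in> crossing_solutions l K n \<tau>"
      and g: "g = ?F (\<tau>, x)"
      by blast
    have "g (target_arc l K c) = g (source_arc l K c) \<triangleright>\<^bsub>Conj (dihedral n)\<^esub> g (over_arc l K c)"
      if c: "c \<in> crossings l K" for c
    proof -
      have "arc_type \<tau> (target_arc l K c) = arc_type \<tau> (source_arc l K c)"
        using crossing_arcs(4)[OF D c] by (simp add: arc_type_def)
      moreover have "int n dvd 2 * int (arc_type \<tau> (source_arc l K c)) * x (over_arc l K c) +
          (- 1) ^ arc_type \<tau> (over_arc l K c) * x (source_arc l K c) - x (target_arc l K c)"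
        using x c by (simp add: crossing_solutions_def)
      ultimately show ?thesis
        using coloring_crossing_iff[where e = "arc_type \<tau>" and x = x, OF D n c arc_type_cases[OF \<tau>]]
          crossing_arcs(1-3)[OF D c]
        by (simp add: g)
    qed
    then show "g \<in> arc_colorings l K (Conj (dihedral n))"
      by (simp add: arc_colorings_def g carT dihedral_elem_closed)
  next
    fix g assume "g \<in> arc_colorings l K (Conj (dihedral n))"
    then have g: "g \<in> arcs l K \<rightarrow>\<^sub>E carrier (dihedral n)"
      and rel: "\<And>c. c \<in> crossings l K \<Longrightarrow> g (target_arc l K c) =
        g (source_arc l K c) \<triangleright>\<^bsub>Conj (dihedral n)\<^esub> g (over_arc l K c)"
      by (simp_all add: arc_colorings_def carT)
    have "\<forall>A\<in>arcs l K. \<exists>p. p \<in> {0, 1} \<times> {0..<int n} \<and> g A = dihedral_elem n (fst p) (snd p)"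
    proof
      fix A assume "A \<in> arcs l K"
      then have "g A \<in> (\<lambda>(e, x). dihedral_elem n e x) ` ({0, 1} \<times> {0..<int n})"
        unfolding bij_betw_imp_surj_on[OF dihedral_elem_bij[OF n]] by (rule PiE_mem[OF g])
      then obtain p where "p \<in> {0, 1} \<times> {0..<int n}" "g A = (\<lambda>(e, x). dihedral_elem n e x) p"
        by (rule imageE)
      then show "\<exists>p. p \<in> {0, 1} \<times> {0..<int n} \<and> g A = dihedral_elem n (fst p) (snd p)"
        by (intro exI[of _ p]) (simp add: case_prod_beta)
    qed
    from bchoice[OF this] obtain p where p: "\<And>A. A \<in> arcs l K \<Longrightarrow> p A \<in> {0, 1} \<times> {0..<int n}"
      "\<And>A. A \<in> arcs l K \<Longrightarrow> g A = dihedral_elem n (fst (p A)) (snd (p A))"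
      by blast
    define e where "e A = fst (p A)" for A
    define x where "x = (\<lambda>A\<in>arcs l K. snd (p A))"
    have e: "e A \<in> {0, 1}" if "A \<in> arcs l K" for A
      using p(1)[OF that] by (auto simp: e_def)
    have x: "x \<in> arcs l K \<rightarrow>\<^sub>E {0..<int n}"
      unfolding x_def restrict_PiE_iff using p(1) by (simp add: mem_Times_iff)
    have ge: "g A = dihedral_elem n (e A) (x A)" if "A \<in> arcs l K" for A
      using p(2)[OF that] that by (simp add: e_def x_def)
    have crossing: "e (target_arc l K c) = e (source_arc l K c) \<and>
        int n dvd 2 * int (e (source_arc l K c)) * x (over_arc l K c) +
          (- 1) ^ e (over_arc l K c) * x (source_arc l K c) - x (target_arc l K c)"
      if c: "c \<in> crossings l K" for c
      using rel[OF c] coloring_crossing_iff[where e = e and x = x, OF D n c e]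
      by (simp only: ge[OF crossing_arcs(1)[OF D c]] ge[OF crossing_arcs(2)[OF D c]]
          ge[OF crossing_arcs(3)[OF D c]])
    \<comment> \<open>The source and the target arc are the pieces before and after, in an order given by the sign.\<close>
    have pass: "e (piece_before l K q) = e (piece_after l K q)" if q: "q \<in> undercrossings l K" for q
    proof -
      obtain c where "c \<in> crossings l K" "q = snd c"
        using q unfolding undercrossings_def by blast
      then show ?thesis
        using crossing[of c] by (auto simp: source_arc_def target_arc_def split: if_splits)
    qed
    \<comment> \<open>The signature is read off from one arc on each component; which one does not matter.\<close>
    define \<tau> where "\<tau> = (\<lambda>j\<in>{..<l}. e (SOME A. A \<in> arcs l K \<and> arc_component A = j))"
    have some_arc: "(SOME A. A \<in> arcs l K \<and> arc_component A = j) \<in> arcs l K \<and>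
        arc_component (SOME A. A \<in> arcs l K \<and> arc_component A = j) = j" if "j < l" for j
      by (rule someI_ex) (use exists_arc[OF fin that] in blast)
    have \<tau>: "\<tau> \<in> signatures l"
      unfolding signatures_def \<tau>_def using some_arc e by (intro restrict_PiE_iff[THEN iffD2]) blast
    have type: "arc_type \<tau> A = e A" if A: "A \<in> arcs l K" for A
    proof -
      note j = some_arc[OF arc_component_less[OF A]]
      show ?thesis
        using label_constant_on_component[OF fin pass j[THEN conjunct1] A j[THEN conjunct2]]
          arc_component_less[OF A]
        by (simp add: arc_type_def \<tau>_def)
    qed
    have "x \<in> crossing_solutions l K n \<tau>"
      using x crossing crossing_arcs(1-3)[OF D] by (simp add: crossing_solutions_def type)
    moreover have "g = ?F (\<tau>, x)"
    proof
      fix A show "g A = ?F (\<tau>, x) A"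
      proof (cases "A \<in> arcs l K")
        case True
        then show ?thesis by (simp add: ge[OF True] type[OF True])
      next
        case False
        then show ?thesis by (simp add: PiE_arb[OF g False])
      qed
    qed
    ultimately show "g \<in> ?F ` ?S" using \<tau> by (intro image_eqI[of _ _ "(\<tau>, x)"] SigmaI)
  qed
qed

lemma sum_nth_distinct:
  assumes "distinct xs"
  shows "(\<Sum>j\<in>{0..<length xs}. h (xs ! j)) = sum h (set xs)"
  using sum.reindex_bij_betw[OF bij_betw_nth[OF assms HOL.refl HOL.refl], of h]
  by (simp add: lessThan_atLeast0)

text \<open>
  The row of the matrix at a crossing evaluates to the linear form of that crossing, also when some
  of its three arcs coincide, because the coefficients of coinciding arcs are added.
\<close>

lemma signature_matrix_mult_vec:
  assumes D: "link_diagram l K" and arcl: "distinct arcl" "set arcl = arcs l K"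
    and i: "i < length crossl" "crossl ! i \<in> crossings l K"
  shows "(signature_matrix l K crossl arcl \<tau> *\<^sub>v vec (length arcl) (\<lambda>j. x (arcl ! j))) $ i =
    2 * int (arc_type \<tau> (source_arc l K (crossl ! i))) * x (over_arc l K (crossl ! i)) +
    (- 1) ^ arc_type \<tau> (over_arc l K (crossl ! i)) * x (source_arc l K (crossl ! i)) -
    x (target_arc l K (crossl ! i))"
proof -
  let ?c = "crossl ! i"
  let ?a = "over_arc l K ?c" and ?b = "source_arc l K ?c" and ?t = "target_arc l K ?c"
  let ?\<delta> = "arc_type \<tau> ?a" and ?\<epsilon> = "arc_type \<tau> ?b"
  define h where "h A = (if A = ?a then 2 * int ?\<epsilon> * x ?a else 0) +
    (if A = ?b then (- 1) ^ ?\<delta> * x ?b else 0) + (if A = ?t then - x ?t else 0)" for A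
  have "(signature_matrix l K crossl arcl \<tau> *\<^sub>v vec (length arcl) (\<lambda>j. x (arcl ! j))) $ i =
      (\<Sum>j\<in>{0..<length arcl}. signature_matrix l K crossl arcl \<tau> $$ (i, j) * x (arcl ! j))"
    using i by (simp add: signature_matrix_def scalar_prod_def)
  also have "\<dots> = (\<Sum>j\<in>{0..<length arcl}. h (arcl ! j))"
    using i by (intro sum.cong HOL.refl)
      (simp add: signature_matrix_def h_def Let_def distrib_right)
  also have "\<dots> = sum h (arcs l K)"
    using sum_nth_distinct[OF arcl(1)] by (simp add: arcl(2))
  also have "\<dots> = 2 * int ?\<epsilon> * x ?a + (- 1) ^ ?\<delta> * x ?b - x ?t"
    using crossing_arcs(1-3)[OF D i(2)] finite_set[of arcl]
    by (simp add: h_def sum.distrib arcl(2))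
  finally show ?thesis .
qed

lemma card_crossing_solutions:
  assumes D: "link_diagram l K" and arcl: "distinct arcl" "set arcl = arcs l K"
    and crossl: "set crossl = crossings l K"
  shows "card (crossing_solutions l K n \<tau>) = card (mod_kernel n (signature_matrix l K crossl arcl \<tau>))"
proof -
  let ?M = "signature_matrix l K crossl arcl \<tau>"
  let ?V = "\<lambda>x. vec (length arcl) (\<lambda>j. x (arcl ! j))"
  have dims: "dim_row ?M = length crossl" "dim_col ?M = length arcl"
    by (simp_all add: signature_matrix_def)
  have kernel: "?V x \<in> mod_kernel n ?M \<longleftrightarrow> x \<in> crossing_solutions l K n \<tau>"
    if "x \<in> extensional (arcs l K)" for x
  proof -
    let ?lin = "\<lambda>c. 2 * int (arc_type \<tau> (source_arc l K c)) * x (over_arc l K c) +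
       (- 1) ^ arc_type \<tau> (over_arc l K c) * x (source_arc l K c) - x (target_arc l K c)"
    have "(\<forall>i<length crossl. int n dvd (?M *\<^sub>v ?V x) $ i) \<longleftrightarrow>
        (\<forall>i<length crossl. int n dvd ?lin (crossl ! i))"
      using signature_matrix_mult_vec[OF D arcl] crossl nth_mem by metis
    also have "\<dots> \<longleftrightarrow> (\<forall>c\<in>crossings l K. int n dvd ?lin c)"
      by (simp only: crossl[symmetric] all_set_conv_all_nth)
    moreover have "(\<forall>j<length arcl. ?V x $ j \<in> {0..<int n}) \<longleftrightarrow> x \<in> arcs l K \<rightarrow>\<^sub>E {0..<int n}"
    proof -
      have "(\<forall>j<length arcl. ?V x $ j \<in> {0..<int n}) \<longleftrightarrow> (\<forall>A\<in>arcs l K. x A \<in> {0..<int n})"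
        unfolding arcl(2)[symmetric] all_set_conv_all_nth by simp
      then show ?thesis using that by (simp only: PiE_iff simp_thms)
    qed
    ultimately show ?thesis
      by (simp only: mod_kernel_def crossing_solutions_def dims mem_Collect_eq vec_carrier simp_thms)
  qed
  have "bij_betw ?V (crossing_solutions l K n \<tau>) (mod_kernel n ?M)"
  proof (rule bij_betw_imageI)
    show "inj_on ?V (crossing_solutions l K n \<tau>)"
    proof (rule inj_onI)
      fix x y assume xy: "x \<in> crossing_solutions l K n \<tau>" "y \<in> crossing_solutions l K n \<tau>"
        and eq: "?V x = ?V y"
      have "x (arcl ! j) = y (arcl ! j)" if "j < length arcl" for j
        using arg_cong[OF eq, of "\<lambda>v. v $ j"] that by simp
      then have "x A = y A" if "A \<in> arcs l K" for A
        using that by (metis arcl(2) in_set_conv_nth)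
      moreover have "x \<in> arcs l K \<rightarrow>\<^sub>E {0..<int n}" "y \<in> arcs l K \<rightarrow>\<^sub>E {0..<int n}"
        using xy by (simp_all add: crossing_solutions_def)
      ultimately show "x = y" by (intro PiE_ext)
    qed
    show "?V ` crossing_solutions l K n \<tau> = mod_kernel n ?M"
    proof (intro equalityI subsetI)
      fix v assume v: "v \<in> mod_kernel n ?M"
      then have dim: "dim_vec v = length arcl"
        by (auto simp: mod_kernel_def dims dest: carrier_vecD)
      define x where "x = (\<lambda>A\<in>arcs l K. v $ (THE j. j < length arcl \<and> arcl ! j = A))"
      have xj: "x (arcl ! j) = v $ j" if "j < length arcl" for j
      proof -
        have "(THE i. i < length arcl \<and> arcl ! i = arcl ! j) = j"
          using that nth_eq_iff_index_eq[OF arcl(1)] by (intro the_equality) auto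
        moreover have "arcl ! j \<in> arcs l K" using that nth_mem arcl(2) by blast
        ultimately show ?thesis by (simp add: x_def)
      qed
      then have "v = ?V x" by (intro eq_vecI) (simp_all add: dim)
      moreover from this have "x \<in> crossing_solutions l K n \<tau>"
        using v kernel[of x] by (simp add: x_def)
      ultimately show "v \<in> ?V ` crossing_solutions l K n \<tau>" by blast
    next
      fix v assume "v \<in> ?V ` crossing_solutions l K n \<tau>"
      then obtain x where x: "x \<in> crossing_solutions l K n \<tau>" "v = ?V x" by blast
      then have "x \<in> extensional (arcs l K)"
        by (simp add: crossing_solutions_def PiE_iff)
      with x kernel show "v \<in> mod_kernel n ?M" by simp
    qed
  qed
  then show ?thesis by (rule bij_betw_same_card)
qed

theorem theorem7p1:
  fixes l n :: nat
    and K :: "nat \<Rightarrow> real \<Rightarrow> complex \<times> real"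
    and arcl :: "link_point set list"
    and crossl :: "(link_point \<times> link_point) list"
    and M :: "(nat \<Rightarrow> nat) \<Rightarrow> int mat"
    and r :: "(nat \<Rightarrow> nat) \<Rightarrow> nat"
    and d :: "(nat \<Rightarrow> nat) \<Rightarrow> nat list"
  assumes "link_diagram l K"
    and "distinct arcl" and "set arcl = arcs l K"
    and "distinct crossl" and "set crossl = crossings l K"
    and "\<And>\<tau>. \<tau> \<in> signatures l \<Longrightarrow> M \<tau> = signature_matrix l K crossl arcl \<tau>"
    and "\<And>\<tau>. \<tau> \<in> signatures l \<Longrightarrow> r \<tau> = int_mat_rank (M \<tau>)"
    and "\<And>\<tau>. \<tau> \<in> signatures l \<Longrightarrow> smith_entries (M \<tau>) (d \<tau>)"
    and "n \<ge> 3"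
  shows "card (qnd_hom (fundamental_quandle l K) (Conj (dihedral n))) =
    (\<Sum>\<tau>\<in>signatures l. n ^ (length arcl - r \<tau>) * (\<Prod>i<r \<tau>. gcd (d \<tau> ! i) n))"
proof -
  note D = assms(1)
  have n: "n > 0" using assms(9) by simp
  have fin_arcs: "finite (arcs l K)" using assms(3) finite_set by metis
  have fin_sig: "finite (signatures l)"
    unfolding signatures_def by (rule finite_PiE) auto
  have fin_sol: "finite (crossing_solutions l K n \<tau>)" for \<tau>
    unfolding crossing_solutions_def
    by (rule finite_subset[of _ "arcs l K \<rightarrow>\<^sub>E {0..<int n}"]) (auto intro: finite_PiE fin_arcs)
  have "card (qnd_hom (fundamental_quandle l K) (Conj (dihedral n))) =
      card (arc_colorings l K (Conj (dihedral n)))"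
    by (rule card_qnd_hom_fundamental_quandle[OF D is_quandle_Conj[OF group_dihedral]])
  also have "\<dots> = card (Sigma (signatures l) (crossing_solutions l K n))"
    using bij_betw_same_card[OF coloring_bij[OF D n]] by simp
  also have "\<dots> = (\<Sum>\<tau>\<in>signatures l. card (crossing_solutions l K n \<tau>))"
    using fin_sig fin_sol by (simp add: card_SigmaI)
  also have "\<dots> = (\<Sum>\<tau>\<in>signatures l. n ^ (length arcl - r \<tau>) * (\<Prod>i<r \<tau>. gcd (d \<tau> ! i) n))"
  proof (intro sum.cong HOL.refl)
    fix \<tau> assume \<tau>: "\<tau> \<in> signatures l"
    have "dim_col (M \<tau>) = length arcl"
      by (simp add: assms(6)[OF \<tau>] signature_matrix_def)
    then show "card (crossing_solutions l K n \<tau>) =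
        n ^ (length arcl - r \<tau>) * (\<Prod>i<r \<tau>. gcd (d \<tau> ! i) n)"
      using card_crossing_solutions[OF D assms(2,3,5), of n \<tau>]
        smith_rank_and_kernel[OF assms(8)[OF \<tau>] n] assms(6,7)[OF \<tau>]
      by simp
  qed
  finally show ?thesis .
qed

end
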